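(* Let $T>0$ and let $B^{\mathcal H}_\alpha$ be the Hadamard fractional Brownian motion with $\alpha\in(0,1)$. Then, for $p>0$, the $p$-variation $V^p(B^{\mathcal H}_\alpha,[0,T])$ is finite and non-zero for $p=\frac2\alpha$, zero for $p>\frac2\alpha$, and infinite for $p<\frac2\alpha$. In particular, the quadratic variation $V^2(B^{\mathcal H}_\alpha,[0,T])$ is infinite.
   Context: Let $B=\{B(t)\}_{t\ge0}$ be a standard Brownian motion. For $\alpha>0$ the Hadamard fractional Brownian motion is the centered Gaussian process $B^{\mathcal H}_\alpha=\{B^{\mathcal H}_\alpha(t)\}_{t\ge 0}$ given by $B^{\mathcal H}_\alpha(0)=0$ and the Wiener integral $$B^{\mathcal H}_\alpha(t)=\frac1{\sqrt{\Gamma(\alpha)}}\int_0^t\Big(\log\frac ts\Big)^{(\alpha-1)/2}dB(s),\qquad t>0.$$ For a process $X$ and $p>0$, the $p$-variation on $[0,T]$ is the limit $$V^p(X,[0,T])=\lim_{n\to\infty}\mathbb E\sum_{k=1}^n\left|X\Big(\frac{Tk}{n}\Big)-X\Big(\frac{T(k-1)}{n}\Big)\right|^p\in[0,\infty];$$ the assertion that the $p$-variation is finite non-zero, zero or infinite includes the existence of this limit. *)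

theory Defs
  imports "HOL-Probability.Probability"
begin

text \<open>
  A stochastic process is a function \<^term>\<open>X :: real \<Rightarrow> 'a \<Rightarrow> real\<close>; only the
  times \<open>t \<ge> 0\<close> are relevant, and nothing is required of its values at negative times.
\<close>

locale standard_brownian_motion = prob_space M
  for M :: "'a measure" and B :: "real \<Rightarrow> 'a \<Rightarrow> real" +
  assumes BM_random_variable: "\<And>t. 0 \<le> t \<Longrightarrow> B t \<in> borel_measurable M"
    and BM_zero: "AE \<omega> in M. B 0 \<omega> = 0"
    and BM_normal_increments: "\<And>s t. 0 \<le> s \<Longrightarrow> s < t \<Longrightarrow>
          distributed M lborel (\<lambda>\<omega>. B t \<omega> - B s \<omega>) (normal_density 0 (sqrt (t - s)))"
    and BM_indep_increments: "\<And>(n::nat) \<tau>. 0 \<le> \<tau> 0 \<Longrightarrow> (\<forall>i<n. \<tau> i < \<tau> (Suc i)) \<Longrightarrow>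
          indep_vars (\<lambda>_. borel) (\<lambda>i \<omega>. B (\<tau> (Suc i)) \<omega> - B (\<tau> i) \<omega>) {..<n}"
    and BM_continuous: "AE \<omega> in M. continuous_on {0..} (\<lambda>t. B t \<omega>)"

text \<open>
  A step function \<open>\<Sum>\<^sub>i c\<^sub>i 1\<^bsub>(u\<^sub>i, v\<^sub>i]\<^esub>\<close> is represented by the list of the triples
  \<open>(c\<^sub>i, u\<^sub>i, v\<^sub>i)\<close>. The intervals may overlap; the integral of the step function
  does not depend on the representation, because it is additive in the intervals.
\<close>

definition is_step :: "real \<Rightarrow> real \<Rightarrow> (real \<times> real \<times> real) list \<Rightarrow> bool" where
  "is_step a b \<phi> \<longleftrightarrow> (\<forall>(c, u, v) \<in> set \<phi>. a \<le> u \<and> u \<le> v \<and> v \<le> b)"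

definition step_fun :: "(real \<times> real \<times> real) list \<Rightarrow> real \<Rightarrow> real" where
  "step_fun \<phi> s = (\<Sum>(c, u, v) \<leftarrow> \<phi>. c * indicator {u<..v} s)"

definition step_integral ::
    "(real \<Rightarrow> 'a \<Rightarrow> real) \<Rightarrow> (real \<times> real \<times> real) list \<Rightarrow> 'a \<Rightarrow> real" where
  "step_integral B \<phi> \<omega> = (\<Sum>(c, u, v) \<leftarrow> \<phi>. c * (B v \<omega> - B u \<omega>))"

text \<open>
  \<open>Y\<close> is (a version of) the Wiener integral \<open>\<integral>\<^sub>a\<^sup>b f dB\<close>: step functions converge to \<open>f\<close>
  in \<open>L\<^sup>2(a, b)\<close> and their integrals converge to \<open>Y\<close> in \<open>L\<^sup>2(M)\<close>. For a Brownian motion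
  \<open>B\<close> and \<open>0 \<le> a\<close>, the Ito isometry makes such a \<open>Y\<close> unique almost surely and
  independent of the approximating sequence, and it exists iff \<open>f\<close> is in \<open>L\<^sup>2(a, b)\<close>.
\<close>

definition has_wiener_integral ::
    "'a measure \<Rightarrow> (real \<Rightarrow> 'a \<Rightarrow> real) \<Rightarrow> real \<Rightarrow> real \<Rightarrow> (real \<Rightarrow> real) \<Rightarrow> ('a \<Rightarrow> real) \<Rightarrow> bool" where
  "has_wiener_integral M B a b f Y \<longleftrightarrow>
     set_borel_measurable lborel {a<..<b} f \<and> Y \<in> borel_measurable M \<and>
     (\<exists>\<phi>. (\<forall>n. is_step a b (\<phi> n)) \<and>
       (\<lambda>n. \<integral>\<^sup>+ s \<in> {a<..<b}. ennreal ((f s - step_fun (\<phi> n) s)\<^sup>2) \<partial>lborel)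
         \<longlonglongrightarrow> 0 \<and>
       (\<lambda>n. \<integral>\<^sup>+ \<omega>. ennreal ((Y \<omega> - step_integral B (\<phi> n) \<omega>)\<^sup>2) \<partial>M) \<longlonglongrightarrow> 0)"

text \<open>
  Since Wiener integrals are only determined almost surely, a Hadamard fractional Brownian
  motion is specified up to modification. That it is centered Gaussian is a consequence.
\<close>

definition hadamard_fBm ::
    "'a measure \<Rightarrow> (real \<Rightarrow> 'a \<Rightarrow> real) \<Rightarrow> real \<Rightarrow> (real \<Rightarrow> 'a \<Rightarrow> real) \<Rightarrow> bool" where
  "hadamard_fBm M B \<alpha> X \<longleftrightarrow>
     (\<forall>t\<ge>0. X t \<in> borel_measurable M) \<and>
     (AE \<omega> in M. X 0 \<omega> = 0) \<and>
     (\<forall>t>0. \<exists>Y. has_wiener_integral M B 0 t (\<lambda>s. ln (t / s) powr ((\<alpha> - 1) / 2)) Y \<and>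
        (AE \<omega> in M. X t \<omega> = 1 / sqrt (Gamma \<alpha>) * Y \<omega>))"

definition has_p_variation ::
    "'a measure \<Rightarrow> (real \<Rightarrow> 'a \<Rightarrow> real) \<Rightarrow> real \<Rightarrow> real \<Rightarrow> ennreal \<Rightarrow> bool" where
  "has_p_variation M X p T V \<longleftrightarrow>
     (\<lambda>n. \<integral>\<^sup>+ \<omega>. ennreal (\<Sum>k = 1..n.
            \<bar>X (T * real k / real n) \<omega> - X (T * (real k - 1) / real n) \<omega>\<bar> powr p) \<partial>M)
       \<longlonglongrightarrow> V"

end

theory Submission
  imports Defs "HOL-Real_Asymp.Real_Asymp"
begin

text \<open>
  Write \<open>h = (\<alpha> - 1) / 2\<close>. An increment of the process is a Wiener integral, hence a centered
  Gaussian variable, and its absolute moment of order \<open>p\<close> is a constant times its variance to the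
  power \<open>p / 2\<close> (\<open>hadamard_increment_moment\<close>). The expected variation along a grid is therefore
  a deterministic sum over the variances.

  The variance over \<open>[s, t]\<close> is the squared norm of the difference of the kernels
  \<open>ln (t / u) powr h\<close> and \<open>ln (s / u) powr h\<close>. With \<open>\<delta> = ln (t / s)\<close> and \<open>u = t exp (- \<delta> x)\<close>
  it becomes \<open>t \<delta> powr \<alpha>\<close> times the Laplace transform at \<open>\<delta>\<close> of a fixed weight, divided by
  \<open>Gamma \<alpha>\<close> (\<open>nn_integral_hadamard_kernel_diff\<close>). The weight is integrable
  (\<open>set_integrable_hadamard_weight\<close>), so for \<open>\<delta> \<rightarrow> 0\<close> the transform tends to the positive total
  mass of the weight.

  On the grid with mesh \<open>T / n\<close> the factor \<open>T / n\<close> comes out by self-similarity, and the \<open>k\<close>-th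
  variance is \<open>T / n\<close> times a quantity asymptotic to a constant times \<open>k powr (1 - \<alpha>)\<close>
  (\<open>unit_increment_variance_asymp\<close>).
  Summing the powers of order \<open>p / 2\<close> over \<open>k \<le> n\<close> (\<open>sum_asymp_powr\<close>) gives a positive constant
  times \<open>n powr (1 - \<alpha> p / 2)\<close> asymptotically, and the sign of the exponent decides between the
  three cases.
\<close>

section \<open>Gaussian limits of integrals of step functions\<close>

lemma telescope_indicator:
  fixes F \<tau> :: "_ \<Rightarrow> real"
  assumes mono: "\<And>i j. i \<le> n \<Longrightarrow> j \<le> n \<Longrightarrow> \<tau> i < \<tau> j \<longleftrightarrow> i < j" and jl: "j \<le> l" "l \<le> n"
  shows "F (\<tau> l) - F (\<tau> j) =
    (\<Sum>i<n. indicator {\<tau> j<..\<tau> l} (\<tau> (Suc i)) * (F (\<tau> (Suc i)) - F (\<tau> i)))"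
proof -
  have "(\<Sum>i<n. indicator {\<tau> j<..\<tau> l} (\<tau> (Suc i)) * (F (\<tau> (Suc i)) - F (\<tau> i)))
      = (\<Sum>i<n. if i \<in> {j..<l} then F (\<tau> (Suc i)) - F (\<tau> i) else 0)"
    using jl mono[of _ j] mono[of _ l] mono[of l] mono[of j]
    by (intro sum.cong) (auto simp: indicator_def not_less[symmetric])
  also have "\<dots> = (\<Sum>i\<in>{..<n} \<inter> {j..<l}. F (\<tau> (Suc i)) - F (\<tau> i))"
    by (simp add: sum.inter_restrict)
  also have "{..<n} \<inter> {j..<l} = {j..<l}"
    using jl by auto
  also have "(\<Sum>i\<in>{j..<l}. F (\<tau> (Suc i)) - F (\<tau> i)) = F (\<tau> l) - F (\<tau> j)"
    using jl sum_Suc_diff'[of j l "\<lambda>i. F (\<tau> i)"] by simp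
  finally show ?thesis ..
qed

text \<open>
  The endpoints of all intervals of \<open>\<phi>\<close>, sorted, cut every interval into consecutive grid cells.
  The identity is stated for an arbitrary path \<open>F\<close>: with \<open>F\<close> a path of the process it writes the
  integral as a sum over disjoint cells, and with \<open>F\<close> the indicator of \<open>{s..}\<close> it does the same
  for the value of the step function at \<open>s\<close>, since \<open>F v - F u\<close> is then the indicator of \<open>(u, v]\<close>.
  The coefficient of a cell is the value at its right endpoint because the cells are left-open.
\<close>

lemma common_partition:
  assumes "is_step 0 b \<phi>"
  shows "\<exists>(n::nat) \<tau>. 0 \<le> \<tau> 0 \<and> (\<forall>i\<le>n. \<forall>j\<le>n. \<tau> i < \<tau> j \<longleftrightarrow> i < j) \<and>
    (\<forall>F::real \<Rightarrow> real. (\<Sum>(c, u, v) \<leftarrow> \<phi>. c * (F v - F u)) =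
       (\<Sum>i<n. step_fun \<phi> (\<tau> (Suc i)) * (F (\<tau> (Suc i)) - F (\<tau> i))))"
proof -
  define S where "S = insert 0 ((\<lambda>(c,u,v). u) ` set \<phi> \<union> (\<lambda>(c,u,v). v) ` set \<phi>)"
  have fin: "finite S" unfolding S_def by auto
  have S0: "\<forall>x\<in>S. 0 \<le> x" "0 \<in> S"
    using assms unfolding S_def is_step_def by fastforce+
  define xs where "xs = sorted_list_of_set S"
  define n where "n = length xs - 1"
  define \<tau> where "\<tau> i = xs ! i" for i
  have set: "set xs = S" and srt: "sorted_wrt (<) xs"
    using fin by (auto simp: xs_def)
  have len: "length xs = Suc n"
    using S0(2) set by (cases xs) (auto simp: n_def)
  have lt: "\<tau> i < \<tau> j" if "i < j" "j \<le> n" for i j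
    using sorted_wrt_nth_less[OF srt] that len unfolding \<tau>_def by auto
  have mono: "\<tau> i < \<tau> j \<longleftrightarrow> i < j" if "i \<le> n" "j \<le> n" for i j
    using lt[of i j] lt[of j i] that by (metis less_asym less_irrefl linorder_neqE_nat)
  have ex: "\<exists>i\<le>n. \<tau> i = x" if "x \<in> S" for x
    using that set len unfolding \<tau>_def by (metis in_set_conv_nth less_Suc_eq_le)
  have tele: "F v - F u = (\<Sum>i<n. indicator {u<..v} (\<tau> (Suc i)) * (F (\<tau> (Suc i)) - F (\<tau> i)))"
    if "(c,u,v) \<in> set \<phi>" for c u v and F :: "real \<Rightarrow> real"
  proof -
    have "u \<in> (\<lambda>(c,u,v). u) ` set \<phi>" "v \<in> (\<lambda>(c,u,v). v) ` set \<phi>"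
      using that by (force intro: image_eqI[where x="(c, u, v)"])+
    then have "u \<in> S" "v \<in> S" by (simp_all add: S_def)
    have "u \<le> v" using that assms by (auto simp: is_step_def)
    obtain j l where jl: "j \<le> n" "\<tau> j = u" "l \<le> n" "\<tau> l = v"
      using ex[OF \<open>u \<in> S\<close>] ex[OF \<open>v \<in> S\<close>] by blast
    then have "j \<le> l"
      using \<open>u \<le> v\<close> mono[of l j] by force
    then show ?thesis
      using telescope_indicator[of n \<tau> j l F, OF mono] jl by simp
  qed
  \<comment> \<open>The grid stays that of \<open>\<phi>\<close> while the list shrinks, so the induction runs over another list.\<close>
  have "(\<Sum>(c, u, v) \<leftarrow> \<psi>. c * (F v - F u)) =
       (\<Sum>i<n. step_fun \<psi> (\<tau> (Suc i)) * (F (\<tau> (Suc i)) - F (\<tau> i)))"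
    if "set \<psi> \<subseteq> set \<phi>" for \<psi> and F :: "real \<Rightarrow> real"
    using that
  proof (induction \<psi>)
    case (Cons a \<psi>)
    obtain c u v where a: "a = (c,u,v)" by (cases a)
    have "c * (F v - F u) = (\<Sum>i<n. c * indicator {u<..v} (\<tau> (Suc i)) * (F (\<tau> (Suc i)) - F (\<tau> i)))"
      using Cons.prems a by (subst tele[of c u v F]) (auto simp only: sum_distrib_left mult.assoc set_simps)
    with Cons show ?case
      by (simp add: a step_fun_def sum.distrib[symmetric] distrib_right)
  qed (simp add: step_fun_def)
  then have "(\<Sum>(c, u, v) \<leftarrow> \<phi>. c * (F v - F u)) =
       (\<Sum>i<n. step_fun \<phi> (\<tau> (Suc i)) * (F (\<tau> (Suc i)) - F (\<tau> i)))" for F :: "real \<Rightarrow> real"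
    by auto
  moreover have "0 \<le> \<tau> 0" using S0 set len unfolding \<tau>_def by (metis nth_mem zero_less_Suc)
  ultimately show ?thesis using mono by (intro exI[of _ n] exI[of _ \<tau>]) simp
qed

lemma borel_measurable_step_fun [measurable]: "step_fun \<phi> \<in> borel_measurable borel"
proof (induction \<phi>)
  case (Cons a \<phi>)
  then show ?case by (cases a) (simp add: step_fun_def[abs_def])
qed (simp add: step_fun_def[abs_def])

lemma step_fun_eq_telescope:
  assumes "is_step a b \<phi>"
  shows "step_fun \<phi> s = (\<Sum>(c, u, v) \<leftarrow> \<phi>. c * (indicator {s..} v - indicator {s..} u))"
  using assms unfolding step_fun_def is_step_def
  by (intro arg_cong[where f=sum_list] map_cong) (auto simp: indicator_def)

lemma step_fun_square:
  assumes \<phi>: "is_step 0 b \<phi>"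
    and mono: "\<And>i j. i \<le> n \<Longrightarrow> j \<le> n \<Longrightarrow> \<tau> i < \<tau> j \<longleftrightarrow> i < j"
    and part: "\<And>F::real \<Rightarrow> real. (\<Sum>(c, u, v) \<leftarrow> \<phi>. c * (F v - F u)) =
       (\<Sum>i<n. d i * (F (\<tau> (Suc i)) - F (\<tau> i)))"
  shows "has_bochner_integral lborel (\<lambda>s. (step_fun \<phi> s)\<^sup>2) (\<Sum>i<n. (d i)\<^sup>2 * (\<tau> (Suc i) - \<tau> i))"
proof -
  let ?I = "\<lambda>i. indicator {\<tau> i<..\<tau> (Suc i)} :: real \<Rightarrow> real"
  have eq: "step_fun \<phi> s = (\<Sum>i<n. d i * ?I i s)" for s
    unfolding step_fun_eq_telescope[OF \<phi>] part
  proof (intro sum.cong refl)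
    fix i assume "i \<in> {..<n}"
    then have "\<tau> i < \<tau> (Suc i)" using mono[of i "Suc i"] by simp
    then show "d i * (indicator {s..} (\<tau> (Suc i)) - indicator {s..} (\<tau> i)) = d i * ?I i s"
      by (auto simp: indicator_def)
  qed
  have disj: "?I i s * ?I j s = (if i = j then ?I i s else 0)" if "i < n" "j < n" for i j s
  proof -
    have "\<not> (s \<in> {\<tau> i<..\<tau> (Suc i)} \<and> s \<in> {\<tau> j<..\<tau> (Suc j)})" if "i \<noteq> j"
    proof
      assume "s \<in> {\<tau> i<..\<tau> (Suc i)} \<and> s \<in> {\<tau> j<..\<tau> (Suc j)}"
      then have "\<tau> i < \<tau> (Suc j)" "\<tau> j < \<tau> (Suc i)" by auto
      then show False using mono[of i "Suc j"] mono[of j "Suc i"] \<open>i < n\<close> \<open>j < n\<close> \<open>i \<noteq> j\<close> by auto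
    qed
    then show ?thesis by (auto simp: indicator_def)
  qed
  have sq: "(step_fun \<phi> s)\<^sup>2 = (\<Sum>i<n. (d i)\<^sup>2 * ?I i s)" for s
  proof -
    have "(step_fun \<phi> s)\<^sup>2 = (\<Sum>i<n. \<Sum>j<n. d i * d j * (?I i s * ?I j s))"
      unfolding eq power2_eq_square sum_product by (simp add: mult_ac)
    also have "\<dots> = (\<Sum>i<n. \<Sum>j<n. if i = j then d i * d j * ?I i s else 0)"
      by (intro sum.cong refl) (simp add: disj)
    also have "\<dots> = (\<Sum>i<n. (d i)\<^sup>2 * ?I i s)"
      by (simp add: power2_eq_square)
    finally show ?thesis .
  qed
  show ?thesis unfolding sq
  proof (rule has_bochner_integral_sum)
    fix i assume "i \<in> {..<n}"
    then have "\<tau> i \<le> \<tau> (Suc i)" using mono[of i "Suc i"] by force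
    then show "has_bochner_integral lborel (\<lambda>s. (d i)\<^sup>2 * ?I i s) ((d i)\<^sup>2 * (\<tau> (Suc i) - \<tau> i))"
      using has_bochner_integral_real_indicator[of "{\<tau> i<..\<tau> (Suc i)}" lborel]
      by (intro has_bochner_integral_mult_right) (auto simp: )
  qed
qed

context standard_brownian_motion begin

lemma char_increment:
  assumes "0 \<le> s" "s < t"
  shows "char (distr M borel (\<lambda>\<omega>. d * (B t \<omega> - B s \<omega>))) \<theta> = exp (- (\<theta>\<^sup>2 / 2 * (d\<^sup>2 * (t - s))))"
proof -
  let ?D = "\<lambda>\<omega>. (B t \<omega> - B s \<omega>) / sqrt (t - s)"
  have [measurable]: "B t \<in> borel_measurable M" "B s \<in> borel_measurable M"
    using BM_random_variable assms by auto
  have "distributed M lborel ?D std_normal_density"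
    using normal_standard_normal_convert[of "sqrt (t - s)" "\<lambda>\<omega>. B t \<omega> - B s \<omega>" 0]
      BM_normal_increments[OF assms] assms by simp
  then have D: "distr M borel ?D = std_normal_distribution"
    by (simp add: distributed_distr_eq_density[symmetric] cong: distr_cong)
  have "char (distr M borel (\<lambda>\<omega>. d * (B t \<omega> - B s \<omega>))) \<theta> =
      char (distr M borel ?D) (\<theta> * d * sqrt (t - s))"
    using assms unfolding char_def by (simp add: integral_distr mult.assoc)
  also have "\<dots> = exp (- (\<theta>\<^sup>2 / 2 * (d\<^sup>2 * (t - s))))"
    using assms by (simp add: D char_std_normal_distribution power_mult_distrib field_simps)
  finally show ?thesis .
qed

lemma borel_measurable_step_integral [measurable]:
  assumes "is_step 0 b \<phi>"
  shows "step_integral B \<phi> \<in> borel_measurable M"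
  using assms
proof (induction \<phi>)
  case (Cons a \<phi>)
  obtain c u v where a: "a = (c,u,v)" by (cases a)
  have [measurable]: "B u \<in> borel_measurable M" "B v \<in> borel_measurable M"
    using Cons.prems BM_random_variable by (auto simp: is_step_def a)
  have [measurable]: "step_integral B \<phi> \<in> borel_measurable M"
    using Cons by (auto simp: is_step_def)
  have "(\<lambda>\<omega>. c * (B v \<omega> - B u \<omega>) + step_integral B \<phi> \<omega>) \<in> borel_measurable M"
    by measurable
  then show ?case by (simp add: step_integral_def[abs_def] a)
qed (simp add: step_integral_def[abs_def])

text \<open>
  On a common partition the integral is a sum of independent centered normal variables, so
  characteristic functions multiply and variances add up to the squared norm. Characteristic
  functions also cover cells with coefficient \<open>0\<close>, for which the summand has no density.
\<close>

lemma step_integral_gaussian: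
  assumes \<phi>: "is_step 0 b \<phi>"
  shows "integrable lborel (\<lambda>s. (step_fun \<phi> s)\<^sup>2)"
    and "char (distr M borel (step_integral B \<phi>)) \<theta> =
          exp (- (\<theta>\<^sup>2 / 2 * (LINT s|lborel. (step_fun \<phi> s)\<^sup>2)))"
proof -
  obtain n :: nat and \<tau> where \<tau>0: "0 \<le> \<tau> 0"
    and mono': "\<forall>i\<le>n. \<forall>j\<le>n. \<tau> i < \<tau> j \<longleftrightarrow> i < j"
    and part': "\<forall>F::real \<Rightarrow> real. (\<Sum>(c, u, v) \<leftarrow> \<phi>. c * (F v - F u)) =
       (\<Sum>i<n. step_fun \<phi> (\<tau> (Suc i)) * (F (\<tau> (Suc i)) - F (\<tau> i)))"
    using common_partition[OF \<phi>] by (elim exE conjE)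
  note mono = mono'[rule_format] and part = part'[rule_format]
  define d where "d i = step_fun \<phi> (\<tau> (Suc i))" for i
  have norm: "has_bochner_integral lborel (\<lambda>s. (step_fun \<phi> s)\<^sup>2) (\<Sum>i<n. (d i)\<^sup>2 * (\<tau> (Suc i) - \<tau> i))"
    using step_fun_square[OF \<phi> mono part] by (simp add: d_def)
  then show "integrable lborel (\<lambda>s. (step_fun \<phi> s)\<^sup>2)"
    by (simp add: has_bochner_integral_iff)
  have "indep_vars (\<lambda>_. borel) (\<lambda>i \<omega>. B (\<tau> (Suc i)) \<omega> - B (\<tau> i) \<omega>) {..<n}"
    using BM_indep_increments[of \<tau> n] \<tau>0 mono by auto
  from indep_vars_compose2[OF this, of "\<lambda>i x. d i * x" "\<lambda>_. borel"]
  have ind: "indep_vars (\<lambda>_. borel) (\<lambda>i \<omega>. d i * (B (\<tau> (Suc i)) \<omega> - B (\<tau> i) \<omega>)) {..<n}"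
    by simp
  have pos: "0 \<le> \<tau> i" if "i \<le> n" for i
    using \<tau>0 mono[of 0 i] that by (cases "i = 0") simp_all
  have "step_integral B \<phi> = (\<lambda>\<omega>. \<Sum>i<n. d i * (B (\<tau> (Suc i)) \<omega> - B (\<tau> i) \<omega>))"
    using part[of "\<lambda>x. B x \<omega>" for \<omega>] by (auto simp: step_integral_def d_def fun_eq_iff)
  then have "char (distr M borel (step_integral B \<phi>)) \<theta> =
     (\<Prod>i<n. complex_of_real (exp (- (\<theta>\<^sup>2 / 2 * ((d i)\<^sup>2 * (\<tau> (Suc i) - \<tau> i))))))"
    using char_increment pos mono
    by (simp only:) (subst char_distr_sum[OF ind], intro prod.cong, auto)
  also have "\<dots> = exp (- (\<theta>\<^sup>2 / 2 * (\<Sum>i<n. (d i)\<^sup>2 * (\<tau> (Suc i) - \<tau> i))))"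
    by (simp only: exp_sum[symmetric, OF finite_lessThan] sum_distrib_left sum_negf of_real_prod[symmetric])
  finally show "char (distr M borel (step_integral B \<phi>)) \<theta> =
          exp (- (\<theta>\<^sup>2 / 2 * (LINT s|lborel. (step_fun \<phi> s)\<^sup>2)))"
    using norm by (simp add: has_bochner_integral_iff)
qed

end

lemma nn_integral_tendsto_zeroD:
  assumes [measurable]: "\<And>n. q n \<in> borel_measurable N" and nonneg: "\<And>n x. 0 \<le> q n x"
    and lim: "(\<lambda>n::nat. \<integral>\<^sup>+ x. ennreal (q n x) \<partial>N) \<longlonglongrightarrow> 0"
  shows "eventually (\<lambda>n. integrable N (q n)) sequentially" "(\<lambda>n. LINT x|N. q n x) \<longlonglongrightarrow> 0"
proof -
  have "eventually (\<lambda>n. (\<integral>\<^sup>+ x. ennreal (q n x) \<partial>N) < 1) sequentially"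
    using order_tendstoD(2)[OF lim] by simp
  then show "eventually (\<lambda>n. integrable N (q n)) sequentially"
    by eventually_elim (auto simp: integrable_iff_bounded nonneg less_top[symmetric] less_trans)
  show "(\<lambda>n. LINT x|N. q n x) \<longlonglongrightarrow> 0"
    using tendsto_enn2real[OF lim[folded ennreal_0]]
    by (simp add: integral_eq_nn_integral nonneg)
qed

text \<open>
  With \<open>d = f\<^sub>n - f\<close> one has \<open>f\<^sub>n\<^sup>2 - f\<^sup>2 = d\<^sup>2 + 2 f d\<close> and \<open>2 |f d| \<le> e f\<^sup>2 + d\<^sup>2 / e\<close>; letting first
  \<open>n\<close> grow and then \<open>e\<close> shrink gives the claim.
\<close>

lemma L2_norm_tendsto:
  fixes f :: "'b \<Rightarrow> real"
  assumes [measurable]: "f \<in> borel_measurable N"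
    and f: "integrable N (\<lambda>x. (f x)\<^sup>2)" and fn: "\<And>n. integrable N (\<lambda>x. (fn n x)\<^sup>2)"
    and [measurable]: "\<And>n. fn n \<in> borel_measurable N"
    and lim: "(\<lambda>n::nat. \<integral>\<^sup>+ x. ennreal ((f x - fn n x)\<^sup>2) \<partial>N) \<longlonglongrightarrow> 0"
  shows "(\<lambda>n. LINT x|N. (fn n x)\<^sup>2) \<longlonglongrightarrow> (LINT x|N. (f x)\<^sup>2)"
proof -
  have ev: "eventually (\<lambda>n. integrable N (\<lambda>x. (f x - fn n x)\<^sup>2)) sequentially"
    and D: "(\<lambda>n. LINT x|N. (f x - fn n x)\<^sup>2) \<longlonglongrightarrow> 0"
    using nn_integral_tendsto_zeroD[OF _ _ lim] by auto
  let ?I = "LINT x|N. (f x)\<^sup>2"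
  have I0: "0 \<le> ?I" by simp
  have bound: "eventually (\<lambda>n. \<bar>(LINT x|N. (fn n x)\<^sup>2) - ?I\<bar> \<le>
      (1 + 1 / e) * (LINT x|N. (f x - fn n x)\<^sup>2) + e * ?I) sequentially" if "e > 0" for e
    using ev
  proof eventually_elim
    case (elim n)
    have pw: "\<bar>(fn n x)\<^sup>2 - (f x)\<^sup>2\<bar> \<le> (1 + 1 / e) * (f x - fn n x)\<^sup>2 + e * (f x)\<^sup>2" for x
    proof -
      let ?d = "fn n x - f x"
      have "0 \<le> (e * \<bar>f x\<bar> - \<bar>?d\<bar>)\<^sup>2 / e" using that by simp
      also have "\<dots> = e * (f x)\<^sup>2 - 2 * \<bar>f x\<bar> * \<bar>?d\<bar> + 1 / e * ?d\<^sup>2"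
        using that by (simp add: power2_eq_square field_simps)
      finally have "2 * \<bar>f x * ?d\<bar> \<le> e * (f x)\<^sup>2 + 1 / e * ?d\<^sup>2" by (simp add: abs_mult)
      moreover have "(fn n x)\<^sup>2 - (f x)\<^sup>2 = ?d\<^sup>2 + 2 * (f x * ?d)"
        by (simp add: power2_eq_square algebra_simps)
      moreover have "(f x - fn n x)\<^sup>2 = ?d\<^sup>2" by (simp add: power2_commute)
      moreover have "0 \<le> ?d\<^sup>2" by simp
      ultimately show ?thesis by (simp only: distrib_right)
    qed
    have "\<bar>(LINT x|N. (fn n x)\<^sup>2) - ?I\<bar> = \<bar>LINT x|N. (fn n x)\<^sup>2 - (f x)\<^sup>2\<bar>"
      using f fn by simp
    also have "\<dots> \<le> (LINT x|N. (1 + 1 / e) * (f x - fn n x)\<^sup>2 + e * (f x)\<^sup>2)"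
      using elim f fn pw by (intro order_trans[OF integral_abs_bound] integral_mono) auto
    also have "\<dots> = (1 + 1 / e) * (LINT x|N. (f x - fn n x)\<^sup>2) + e * ?I"
      using elim f by simp
    finally show ?case .
  qed
  show ?thesis
  proof (rule LIMSEQ_I)
    fix r :: real assume "r > 0"
    define e where "e = r / (2 * (1 + ?I))"
    have e: "e > 0" "e * ?I < r"
    proof -
      show "e > 0" using \<open>r > 0\<close> I0 by (auto simp: e_def intro!: divide_pos_pos add_pos_nonneg)
      have "?I * r / (2 * (1 + ?I)) < r"
        using \<open>r > 0\<close> I0 by (subst pos_divide_less_eq) (use mult_nonneg_nonneg[OF I0 less_imp_le[OF \<open>r > 0\<close>]] in \<open>auto simp: algebra_simps intro: add_pos_nonneg\<close>)
      then show "e * ?I < r" by (simp add: e_def mult_ac)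
    qed
    have "(\<lambda>n. (1 + 1 / e) * (LINT x|N. (f x - fn n x)\<^sup>2) + e * ?I) \<longlonglongrightarrow> (1 + 1/e) * 0 + e * ?I"
      by (intro tendsto_intros D)
    then have "eventually (\<lambda>n. (1 + 1 / e) * (LINT x|N. (f x - fn n x)\<^sup>2) + e * ?I < r) sequentially"
      using order_tendstoD(2) e by force
    with bound[OF e(1)] have "eventually (\<lambda>n. norm ((LINT x|N. (fn n x)\<^sup>2) - ?I) < r) sequentially"
      by eventually_elim (simp only: real_norm_def)
    then show "\<exists>no. \<forall>n\<ge>no. norm ((LINT x|N. (fn n x)\<^sup>2) - ?I) < r"
      by (simp add: eventually_sequentially)
  qed
qed

text \<open>
  The function \<open>x \<mapsto> exp (i \<theta> x)\<close> is Lipschitz, and \<open>|y| \<le> e + y\<^sup>2 / e\<close> turns the resulting first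
  moment into a second moment.
\<close>

lemma (in prob_space) char_tendsto_L2:
  assumes [measurable]: "Z \<in> borel_measurable M" "\<And>n. Zn n \<in> borel_measurable M"
    and lim: "(\<lambda>n::nat. \<integral>\<^sup>+ \<omega>. ennreal ((Z \<omega> - Zn n \<omega>)\<^sup>2) \<partial>M) \<longlonglongrightarrow> 0"
  shows "(\<lambda>n. char (distr M borel (Zn n)) \<theta>) \<longlonglongrightarrow> char (distr M borel Z) \<theta>"
proof -
  have ev: "eventually (\<lambda>n. integrable M (\<lambda>\<omega>. (Z \<omega> - Zn n \<omega>)\<^sup>2)) sequentially"
    and D: "(\<lambda>n. expectation (\<lambda>\<omega>. (Z \<omega> - Zn n \<omega>)\<^sup>2)) \<longlonglongrightarrow> 0"
    using nn_integral_tendsto_zeroD[OF _ _ lim] by auto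
  have int: "integrable M (\<lambda>\<omega>. iexp (\<theta> * W \<omega>))" if "W \<in> borel_measurable M" for W
    using that by (intro integrable_const_bound[of _ 1]) auto
  have bound: "eventually (\<lambda>n. norm (char (distr M borel (Zn n)) \<theta> - char (distr M borel Z) \<theta>) \<le>
      e + \<theta>\<^sup>2 / e * expectation (\<lambda>\<omega>. (Z \<omega> - Zn n \<omega>)\<^sup>2)) sequentially" if "e > 0" for e
    using ev
  proof eventually_elim
    case (elim n)
    have pw: "cmod (iexp (\<theta> * Zn n \<omega>) - iexp (\<theta> * Z \<omega>)) \<le> e + \<theta>\<^sup>2 / e * (Z \<omega> - Zn n \<omega>)\<^sup>2" for \<omega>
    proof -
      let ?y = "\<theta> * Zn n \<omega> - \<theta> * Z \<omega>"
      have "iexp (\<theta> * Zn n \<omega>) - iexp (\<theta> * Z \<omega>) = iexp (\<theta> * Z \<omega>) * (iexp ?y - 1)"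
        by (simp add: algebra_simps flip: exp_add)
      then have "cmod (iexp (\<theta> * Zn n \<omega>) - iexp (\<theta> * Z \<omega>)) = cmod (iexp ?y - 1)"
        by (simp add: norm_mult)
      also have "\<dots> \<le> \<bar>?y\<bar>"
        using iexp_approx1[of ?y 0] by simp
      also have "\<dots> \<le> e + ?y\<^sup>2 / e"
      proof (cases "\<bar>?y\<bar> \<le> e")
        case False
        then have "\<bar>?y\<bar> * e \<le> \<bar>?y\<bar> * \<bar>?y\<bar>" by (intro mult_left_mono) auto
        then have "\<bar>?y\<bar> \<le> ?y\<^sup>2 / e" using that by (simp add: pos_le_divide_eq power2_eq_square)
        then show ?thesis using that by simp
      qed (use that in \<open>simp add: add_increasing2\<close>)
      also have "?y\<^sup>2 = \<theta>\<^sup>2 * (Z \<omega> - Zn n \<omega>)\<^sup>2"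
        by (simp add: power2_eq_square algebra_simps)
      finally show ?thesis by simp
    qed
    have "norm (char (distr M borel (Zn n)) \<theta> - char (distr M borel Z) \<theta>) =
       norm (integral\<^sup>L M (\<lambda>\<omega>. iexp (\<theta> * Zn n \<omega>) - iexp (\<theta> * Z \<omega>)))"
      using int by (simp add: char_def integral_distr)
    also have "\<dots> \<le> expectation (\<lambda>\<omega>. e + \<theta>\<^sup>2 / e * (Z \<omega> - Zn n \<omega>)\<^sup>2)"
      using elim pw int by (intro order_trans[OF integral_norm_bound] integral_mono) auto
    also have "\<dots> = e + \<theta>\<^sup>2 / e * expectation (\<lambda>\<omega>. (Z \<omega> - Zn n \<omega>)\<^sup>2)"
      using elim by (simp add: prob_space)
    finally show ?case .
  qed
  show ?thesis
  proof (rule LIMSEQ_I)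
    fix r :: real assume "r > 0"
    then have e: "r / 2 > 0" by simp
    have "(\<lambda>n. r / 2 + \<theta>\<^sup>2 / (r / 2) * expectation (\<lambda>\<omega>. (Z \<omega> - Zn n \<omega>)\<^sup>2))
        \<longlonglongrightarrow> r / 2 + \<theta>\<^sup>2 / (r / 2) * 0"
      by (intro tendsto_intros D)
    then have "eventually (\<lambda>n. r / 2 + \<theta>\<^sup>2 / (r / 2) * expectation (\<lambda>\<omega>. (Z \<omega> - Zn n \<omega>)\<^sup>2) < r) sequentially"
      using order_tendstoD(2) \<open>r > 0\<close> by force
    with bound[OF e] have "eventually (\<lambda>n. norm (char (distr M borel (Zn n)) \<theta> - char (distr M borel Z) \<theta>) < r) sequentially"
      by eventually_elim simp
    then show "\<exists>no. \<forall>n\<ge>no. norm (char (distr M borel (Zn n)) \<theta> - char (distr M borel Z) \<theta>) < r"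
      by (simp add: eventually_sequentially)
  qed
qed

text \<open>
  The Ito isometry at the level of laws: the characteristic functions of the approximating
  integrals converge both to that of \<open>Z\<close> and, since the squared norms converge, to a Gaussian one.
\<close>

lemma (in standard_brownian_motion) step_limit_gaussian:
  assumes [measurable]: "g \<in> borel_measurable borel" "Z \<in> borel_measurable M"
    and g: "integrable lborel (\<lambda>s. (g s)\<^sup>2)" and \<phi>: "\<And>n. is_step 0 (b n) (\<phi> n)"
    and lim_g: "(\<lambda>n. \<integral>\<^sup>+ s. ennreal ((g s - step_fun (\<phi> n) s)\<^sup>2) \<partial>lborel) \<longlonglongrightarrow> 0"
    and lim_Z: "(\<lambda>n. \<integral>\<^sup>+ \<omega>. ennreal ((Z \<omega> - step_integral B (\<phi> n) \<omega>)\<^sup>2) \<partial>M) \<longlonglongrightarrow> 0"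
  shows "char (distr M borel Z) \<theta> = exp (- (\<theta>\<^sup>2 / 2 * (LINT s|lborel. (g s)\<^sup>2)))"
proof -
  have "(\<lambda>n. LINT s|lborel. (step_fun (\<phi> n) s)\<^sup>2) \<longlonglongrightarrow> (LINT s|lborel. (g s)\<^sup>2)"
    using g lim_g step_integral_gaussian(1)[OF \<phi>] by (intro L2_norm_tendsto) auto
  then have "(\<lambda>n. complex_of_real (exp (- (\<theta>\<^sup>2 / 2 * (LINT s|lborel. (step_fun (\<phi> n) s)\<^sup>2))))) \<longlonglongrightarrow>
      exp (- (\<theta>\<^sup>2 / 2 * (LINT s|lborel. (g s)\<^sup>2)))"
    by (intro tendsto_intros)
  moreover have "(\<lambda>n. char (distr M borel (step_integral B (\<phi> n))) \<theta>) \<longlonglongrightarrow> char (distr M borel Z) \<theta>"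
    using lim_Z borel_measurable_step_integral[OF \<phi>] by (intro char_tendsto_L2) auto
  ultimately show ?thesis
    using LIMSEQ_unique step_integral_gaussian(2)[OF \<phi>] by auto
qed

definition gauss_abs_moment :: "real \<Rightarrow> real" where
  "gauss_abs_moment p = (LINT x|std_normal_distribution. \<bar>x\<bar> powr p)"

lemma nn_integral_gauss_abs_moment:
  assumes "p > 0"
  shows "(\<integral>\<^sup>+ x. ennreal (\<bar>x\<bar> powr p) \<partial>std_normal_distribution) = ennreal (gauss_abs_moment p)"
    and "gauss_abs_moment p > 0"
proof -
  interpret real_distribution std_normal_distribution by (rule real_dist_normal_dist)
  define m where "m = nat \<lceil>p\<rceil>"
  \<comment> \<open>Real powers are dominated by \<open>1\<close> plus the next natural power.\<close>
  have "integrable std_normal_distribution (\<lambda>x. \<bar>x ^ m\<bar>)"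
    by (intro integrable_abs integrable_std_normal_distribution_moment)
  then have "integrable std_normal_distribution (\<lambda>x. 1 + \<bar>x ^ m\<bar>)" by simp
  then have int: "integrable std_normal_distribution (\<lambda>x. \<bar>x\<bar> powr p)"
  proof (rule Bochner_Integration.integrable_bound)
    show "AE x in std_normal_distribution. norm (\<bar>x\<bar> powr p) \<le> norm (1 + \<bar>x ^ m\<bar>)"
    proof (rule AE_I2)
      fix x :: real
      have "\<bar>x\<bar> powr p \<le> 1 + \<bar>x\<bar> ^ m"
      proof (cases "\<bar>x\<bar> \<le> 1")
        case True
        then have "\<bar>x\<bar> powr p \<le> 1" using assms by (intro powr_le1) auto
        then show ?thesis by (simp add: add_increasing2)
      next
        case False
        then have "\<bar>x\<bar> powr p \<le> \<bar>x\<bar> powr m"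
          by (intro powr_mono) (use assms in \<open>auto simp: m_def real_nat_ceiling_ge\<close>)
        also have "\<dots> = \<bar>x\<bar> ^ m" using False by (intro powr_realpow) auto
        finally show ?thesis by simp
      qed
      then show "norm (\<bar>x\<bar> powr p) \<le> norm (1 + \<bar>x ^ m\<bar>)" by (simp add: power_abs)
    qed
  qed simp
  then show *: "(\<integral>\<^sup>+ x. ennreal (\<bar>x\<bar> powr p) \<partial>std_normal_distribution) = ennreal (gauss_abs_moment p)"
    unfolding gauss_abs_moment_def by (intro nn_integral_eq_integral) auto
  have "\<not> (AE x in std_normal_distribution. x = 0)"
  proof
    assume "AE x in std_normal_distribution. x = 0"
    then have "AE x in lborel. x = (0::real)"
      by (subst (asm) AE_density) (auto simp: normal_density_pos)
    then have "emeasure lborel (- {0::real}) = 0"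
      by (subst (asm) AE_iff_measurable[of "- {0}"]) auto
    moreover have "emeasure lborel {0<..<1::real} \<le> emeasure lborel (- {0::real})"
      by (intro emeasure_mono) auto
    ultimately show False by simp
  qed
  then have "gauss_abs_moment p \<noteq> 0"
    using int unfolding gauss_abs_moment_def by (subst integral_nonneg_eq_0_iff_AE) auto
  moreover have "gauss_abs_moment p \<ge> 0" unfolding gauss_abs_moment_def by simp
  ultimately show "gauss_abs_moment p > 0" by simp
qed

text \<open>
  Standardize \<open>Z\<close>, identify its law by Levy's uniqueness theorem, and scale back.
\<close>

lemma (in prob_space) gaussian_abs_moment:
  assumes [measurable]: "Z \<in> borel_measurable M"
    and char: "\<And>\<theta>. char (distr M borel Z) \<theta> = exp (- (\<theta>\<^sup>2 / 2 * v))"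
    and "v > 0" "p > 0"
  shows "(\<integral>\<^sup>+ \<omega>. ennreal (\<bar>Z \<omega>\<bar> powr p) \<partial>M) = ennreal (gauss_abs_moment p * v powr (p / 2))"
proof -
  let ?W = "\<lambda>\<omega>. Z \<omega> / sqrt v"
  have "char (distr M borel ?W) \<theta> = char std_normal_distribution \<theta>" for \<theta>
  proof -
    have "char (distr M borel ?W) \<theta> = char (distr M borel Z) (\<theta> / sqrt v)"
      by (simp add: char_def integral_distr)
    also have "\<dots> = char std_normal_distribution \<theta>"
      using \<open>v > 0\<close> by (simp add: char char_std_normal_distribution power_divide)
    finally show ?thesis .
  qed
  then have "distr M borel ?W = std_normal_distribution"
    by (intro Levy_uniqueness real_dist_normal_dist real_distribution_distr) auto
  then have "ennreal (gauss_abs_moment p) = (\<integral>\<^sup>+ x. ennreal (\<bar>x\<bar> powr p) \<partial>distr M borel ?W)"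
    using nn_integral_gauss_abs_moment \<open>p > 0\<close> by simp
  also have "\<dots> = (\<integral>\<^sup>+ \<omega>. ennreal (\<bar>?W \<omega>\<bar> powr p) \<partial>M)"
    by (subst nn_integral_distr) auto
  finally have "ennreal (gauss_abs_moment p * v powr (p / 2)) =
      (\<integral>\<^sup>+ \<omega>. ennreal (v powr (p / 2)) * ennreal (\<bar>?W \<omega>\<bar> powr p) \<partial>M)"
    by (subst nn_integral_cmult) (auto simp: ennreal_mult'' mult.commute)
  also have "\<dots> = (\<integral>\<^sup>+ \<omega>. ennreal (\<bar>Z \<omega>\<bar> powr p) \<partial>M)"
  proof (intro nn_integral_cong)
    fix \<omega>
    have "v powr (p / 2) * \<bar>?W \<omega>\<bar> powr p = \<bar>Z \<omega>\<bar> powr p"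
      using \<open>v > 0\<close>
      by (simp add: abs_divide powr_divide powr_powr powr_half_sqrt[symmetric])
    then show "ennreal (v powr (p / 2)) * ennreal (\<bar>?W \<omega>\<bar> powr p) = ennreal (\<bar>Z \<omega>\<bar> powr p)"
      by (simp add: ennreal_mult'[symmetric])
  qed
  finally show ?thesis ..
qed

section \<open>The norm of differences of Hadamard kernels\<close>

text \<open>
  The substitution \<open>u = t exp (- \<delta> x)\<close>, a decreasing bijection from \<open>(0, \<infinity>)\<close> onto \<open>(0, t)\<close>.
\<close>

lemma nn_integral_log_substitution:
  fixes F :: "real \<Rightarrow> real"
  assumes "0 < t" "0 < \<delta>" and [measurable]: "F \<in> borel_measurable borel" and F0: "\<And>x. 0 \<le> F x"
    and int: "set_integrable lborel {0<..} (\<lambda>x. F x * exp (- (\<delta> * x)))"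
  shows "(\<integral>\<^sup>+ u \<in> {0<..<t}. ennreal (F (ln (t / u) / \<delta>)) \<partial>lborel) =
    ennreal (t * \<delta> * (LBINT x:{0<..}. F x * exp (- (\<delta> * x))))"
proof -
  let ?g = "\<lambda>x. t * exp (- (\<delta> * x))" and ?g' = "\<lambda>x. - (t * \<delta> * exp (- (\<delta> * x)))"
  let ?f = "\<lambda>u. F (ln (t / u) / \<delta>)"
  have fg: "?f (?g x) = F x" for x
    using assms(1,2) by (simp add: ln_div)
  have img: "?g ` {0<..} = {0<..<t}"
  proof (intro equalityI subsetI)
    fix u assume u: "u \<in> {0<..<t}"
    then have "u = ?g (ln (t / u) / \<delta>)" "ln (t / u) / \<delta> > 0"
      using assms(1,2) by (auto simp: exp_minus)
    then show "u \<in> ?g ` {0<..}" by blast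
  qed (use assms(1,2) in auto)
  have "(\<lambda>x. t * \<delta> * (F x * exp (- (\<delta> * x)))) absolutely_integrable_on {0<..}"
    using int by (intro set_integrable_mult_right)
      (auto simp: set_integrable_def intro!: integrable_completion[THEN iffD2])
  then have 1: "(\<lambda>x. \<bar>?g' x\<bar> * ?f (?g x)) absolutely_integrable_on {0<..}"
    unfolding fg using assms(1,2) by (simp add: mult_ac abs_mult)
  have 2: "integral {0<..} (\<lambda>x. \<bar>?g' x\<bar> * ?f (?g x)) = t * \<delta> * (LBINT x:{0<..}. F x * exp (- (\<delta> * x)))"
    unfolding fg using assms(1,2) set_borel_integral_eq_integral(2)[OF int]
    by (simp add: mult_ac abs_mult flip: integral_mult_right)
  have 3: "?f absolutely_integrable_on {0<..<t} \<and>
      integral {0<..<t} ?f = t * \<delta> * (LBINT x:{0<..}. F x * exp (- (\<delta> * x)))"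
    unfolding img[symmetric]
  proof (rule has_absolute_integral_change_of_variables_1'[where S = "{0<..}" and g = ?g and g' = ?g', THEN iffD1])
    show "(\<lambda>x. \<bar>?g' x\<bar> * ?f (?g x)) absolutely_integrable_on {0<..} \<and>
      integral {0<..} (\<lambda>x. \<bar>?g' x\<bar> * ?f (?g x)) = t * \<delta> * (LBINT x:{0<..}. F x * exp (- (\<delta> * x)))"
      using 1 2 by blast
    show "inj_on ?g {0<..}" using assms(1,2) by (auto intro!: inj_onI)
    show "(?g has_field_derivative ?g' x) (at x within {0<..})" for x
      by (auto intro!: derivative_eq_intros)
  qed auto
  then have "(?f has_integral (t * \<delta> * (LBINT x:{0<..}. F x * exp (- (\<delta> * x))))) {0<..<t}"
    using set_lebesgue_integral_eq_integral(1) by (metis integrable_integral)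
  from nn_integral_has_integral_lebesgue[OF _ this] F0
  show ?thesis by (simp add: mult.commute ennreal_mult' ennreal_indicator cong: nn_integral_cong)
qed

text \<open>
  The squared difference of the kernels of two times \<open>s < t\<close>, in the variable \<open>x = ln (t / u) / ln (t / s)\<close>
  and up to a power of \<open>ln (t / s)\<close>. It is the squared Mandelbrot--Van Ness kernel of a
  fractional Brownian motion of Hurst index \<open>h + 1/2\<close>, which reflects the behaviour away from time \<open>0\<close>.
\<close>

definition hadamard_weight :: "real \<Rightarrow> real \<Rightarrow> real" where
  "hadamard_weight h x = (x powr h - (if x > 1 then (x - 1) powr h else 0))\<^sup>2"

lemma borel_measurable_hadamard_weight [measurable]: "hadamard_weight h \<in> borel_measurable borel"
  unfolding hadamard_weight_def[abs_def] by measurable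

text \<open>
  The mean value theorem makes the difference of the two powers of order \<open>x powr (h - 1)\<close>. The
  bound uses \<open>x / 2\<close> instead of \<open>x - 1\<close> so that it is a multiple of a pure power.
\<close>

lemma hadamard_weight_tail:
  assumes "- 1 / 2 < h" "h < 0" "x > 2"
  shows "hadamard_weight h x \<le> (x / 2) powr (2 * h - 2)"
proof -
  have "\<exists>z. x - 1 < z \<and> z < x \<and> x powr h - (x - 1) powr h = (x - (x - 1)) * (h * z powr (h - 1))"
    using assms by (intro MVT2) (auto intro!: derivative_eq_intros)
  then obtain z where z: "x - 1 < z" "x powr h - (x - 1) powr h = h * z powr (h - 1)"
    by auto
  have "hadamard_weight h x = h\<^sup>2 * (z powr (h - 1))\<^sup>2"
    using assms z by (simp add: hadamard_weight_def power_mult_distrib)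
  also have "\<dots> \<le> 1 * (z powr (h - 1))\<^sup>2"
    using assms by (intro mult_right_mono) (auto simp: abs_square_le_1)
  also have "\<dots> = z powr (2 * h - 2)"
    using z assms by (simp add: power2_eq_square flip: powr_add)
  also have "\<dots> \<le> (x / 2) powr (2 * h - 2)"
    using z assms by (intro powr_mono2') auto
  finally show ?thesis by simp
qed

text \<open>
  Both powers are non-negative and the one of \<open>x - 1\<close> is the larger, since the exponent is negative.
\<close>

lemma hadamard_weight_middle:
  assumes "h < 0" "x > 1"
  shows "hadamard_weight h x \<le> (x - 1) powr (2 * h)"
proof -
  have "x powr h \<le> (x - 1) powr h" using assms by (intro powr_mono2') auto
  then have "\<bar>x powr h - (x - 1) powr h\<bar> \<le> (x - 1) powr h" by (simp add: abs_if)
  then have "(x powr h - (x - 1) powr h)\<^sup>2 \<le> ((x - 1) powr h)\<^sup>2"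
    by (simp add: abs_le_square_iff[symmetric])
  then show ?thesis using assms by (simp add: hadamard_weight_def power2_eq_square flip: powr_add)
qed

text \<open>
  There are three delicate places: the singularities at \<open>0\<close> and at \<open>1\<close>, of order \<open>2 h > - 1\<close>, and
  infinity, where the weight decays like \<open>x powr (2 h - 2)\<close>.
\<close>

lemma set_integrable_hadamard_weight:
  assumes "- 1 / 2 < h" "h < 0"
  shows "set_integrable lborel {0<..} (hadamard_weight h)"
proof -
  have pow: "set_integrable lborel {0<..1} (\<lambda>x. x powr (2 * h))"
  proof -
    have "(\<lambda>x. x powr (2 * h)) absolutely_integrable_on {0<..1}"
      using assms by (intro nonnegative_absolutely_integrable_1 integrable_on_powr_from_0') auto
    then show ?thesis
      by (simp add: set_integrable_def integrable_completion)
  qed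
  have A: "set_integrable lborel {0<..1} (hadamard_weight h)"
    using pow by (rule set_integrable_cong[THEN iffD1, rotated -1])
      (auto simp: hadamard_weight_def power2_eq_square simp flip: powr_add)
  have "integrable lborel (\<lambda>x. indicator {0<..1} (-1 + 1 * x) *\<^sub>R ((-1 + 1 * x) powr (2 * h)))"
    using pow unfolding set_integrable_def
    by (intro lborel_integrable_real_affine[where f="\<lambda>x. indicator {0<..1} x *\<^sub>R (x powr (2 * h))"]) auto
  also have "(\<lambda>x. indicator {0<..1} (-1 + 1 * x) *\<^sub>R ((-1 + 1 * x) powr (2 * h))) =
      (\<lambda>x::real. indicator {1<..2} x *\<^sub>R ((x - 1) powr (2 * h)))"
    by (auto simp: indicator_def fun_eq_iff)
  finally have pow1: "set_integrable lborel {1<..2} (\<lambda>x. (x - 1) powr (2 * h))"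
    unfolding set_integrable_def .
  have B: "set_integrable lborel {1<..2} (hadamard_weight h)"
    using pow1 by (rule set_integrable_bound)
      (use hadamard_weight_middle[OF assms(2)] in \<open>auto simp: hadamard_weight_def set_borel_measurable_def\<close>)
  have "((\<lambda>x. x powr (2 * h - 2)) has_integral (-(2 powr (2 * h - 2 + 1)) / (2 * h - 2 + 1))) {2..}"
    using assms by (intro has_integral_powr_to_inf) auto
  then have "(\<lambda>x::real. x powr (2 * h - 2)) absolutely_integrable_on {2..}"
    by (intro nonnegative_absolutely_integrable_1) auto
  then have "set_integrable lborel {2..} (\<lambda>x. x powr (2 * h - 2))"
    by (simp add: set_integrable_def integrable_completion)
  then have "set_integrable lborel {2<..} (\<lambda>x. x powr (2 * h - 2))"
    by (rule set_integrable_subset) auto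
  then have "set_integrable lborel {2<..} (\<lambda>x. (1/2) powr (2 * h - 2) * x powr (2 * h - 2))"
    by (intro set_integrable_mult_right) auto
  then have C: "set_integrable lborel {2<..} (hadamard_weight h)"
    by (rule set_integrable_bound)
      (use hadamard_weight_tail[OF assms] in \<open>auto simp: hadamard_weight_def set_borel_measurable_def powr_mult[symmetric]\<close>)
  have "set_integrable lborel ({0<..1} \<union> ({1<..2} \<union> {2<..})) (hadamard_weight h)"
    by (intro set_integrable_Un A B C) auto
  also have "{0<..1} \<union> ({1<..2} \<union> {2<..}) = {0::real<..}" by auto
  finally show ?thesis .
qed

text \<open>
  The Laplace transform of the weight. The parameter \<open>\<delta> = ln (t / s)\<close> is the logarithmic distance
  of two times, and the exponential is, up to a constant, the Jacobian of the logarithmic substitution.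
\<close>

definition hadamard_weight_laplace :: "real \<Rightarrow> real \<Rightarrow> real" where
  "hadamard_weight_laplace h \<delta> = (LBINT x:{0<..}. hadamard_weight h x * exp (- (\<delta> * x)))"

lemma hadamard_weight_discounted_integrable:
  assumes "- 1 / 2 < h" "h < 0" "0 \<le> \<delta>"
  shows "set_integrable lborel {0<..} (\<lambda>x. hadamard_weight h x * exp (- (\<delta> * x)))"
  using set_integrable_hadamard_weight[OF assms(1,2)]
proof (rule set_integrable_bound)
  show "AE x in lborel. x \<in> {0<..} \<longrightarrow> norm (hadamard_weight h x * exp (- (\<delta> * x))) \<le> norm (hadamard_weight h x)"
    using assms(3) by (auto simp: abs_mult intro!: mult_right_le_one_le)
qed (simp add: set_borel_measurable_def)

lemma hadamard_weight_laplace_pos: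
  assumes "- 1 / 2 < h" "h < 0" "0 \<le> \<delta>"
  shows "0 < hadamard_weight_laplace h \<delta>"
proof -
  let ?f = "\<lambda>x. indicator {0<..} x *\<^sub>R (hadamard_weight h x * exp (- (\<delta> * x)))"
  have f0: "0 \<le> ?f x" for x by (auto simp: hadamard_weight_def)
  have int: "integrable lborel ?f"
    using hadamard_weight_discounted_integrable[OF assms] by (simp add: set_integrable_def)
  have "integral\<^sup>L lborel ?f \<noteq> 0"
  proof
    assume "integral\<^sup>L lborel ?f = 0"
    then have "AE x in lborel. ?f x = 0"
      using integral_nonneg_eq_0_iff_AE[OF int] f0 by auto
    then have "AE x in lborel. x \<notin> {0<..1::real}"
      by eventually_elim (auto simp: hadamard_weight_def)
    then have "emeasure lborel {0<..1::real} = 0"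
      by (subst (asm) AE_iff_measurable[of "{0<..1}"]) auto
    then show False by simp
  qed
  moreover have "integral\<^sup>L lborel ?f \<ge> 0" using f0 by (intro Bochner_Integration.integral_nonneg) auto
  ultimately show ?thesis by (simp add: hadamard_weight_laplace_def set_lebesgue_integral_def)
qed

lemma hadamard_weight_laplace_tendsto:
  assumes "- 1 / 2 < h" "h < 0" and d: "\<And>n. 0 \<le> d n" "d \<longlonglongrightarrow> 0"
  shows "(\<lambda>n. hadamard_weight_laplace h (d n)) \<longlonglongrightarrow> hadamard_weight_laplace h 0"
  unfolding hadamard_weight_laplace_def set_lebesgue_integral_def
proof (rule integral_dominated_convergence)
  show "integrable lborel (\<lambda>x. indicator {0<..} x *\<^sub>R hadamard_weight h x)"
    using set_integrable_hadamard_weight[OF assms(1,2)] by (simp add: set_integrable_def)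
  show "AE x in lborel. (\<lambda>n. indicator {0<..} x *\<^sub>R (hadamard_weight h x * exp (- (d n * x))))
      \<longlonglongrightarrow> indicator {0<..} x *\<^sub>R (hadamard_weight h x * exp (- (0 * x)))"
    by (intro AE_I2 tendsto_intros d)
  show "AE x in lborel. norm (indicator {0<..} x *\<^sub>R (hadamard_weight h x * exp (- (d n * x))))
      \<le> indicator {0<..} x *\<^sub>R hadamard_weight h x" for n
    using d by (auto simp: indicator_def hadamard_weight_def abs_mult intro!: mult_right_le_one_le)
qed auto

definition hadamard_kernel :: "real \<Rightarrow> real \<Rightarrow> real \<Rightarrow> real" where
  "hadamard_kernel h t u = indicator {0<..<t} u * ln (t / u) powr h"

lemma borel_measurable_hadamard_kernel [measurable]: "hadamard_kernel h t \<in> borel_measurable borel"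
  unfolding hadamard_kernel_def[abs_def] by measurable

lemma hadamard_kernel_diff_square:
  assumes "0 < s" "s < t"
  shows "(hadamard_kernel h t u - hadamard_kernel h s u)\<^sup>2 =
    ln (t / s) powr (2 * h) * hadamard_weight h (ln (t / u) / ln (t / s)) * indicator {0<..<t} u"
proof (cases "u \<in> {0<..<t}")
  case True
  let ?\<delta> = "ln (t / s)" let ?x = "ln (t / u) / ?\<delta>"
  have \<delta>: "?\<delta> > 0" using assms by simp
  have x: "?x > 0" "ln (t / u) = ?\<delta> * ?x" using True \<delta> by auto
  have us: "u < s \<longleftrightarrow> ?x > 1"
  proof -
    have "?x > 1 \<longleftrightarrow> ln (t / u) > ln (t / s)" using \<delta> by (simp add: less_divide_eq)
    also have "\<dots> \<longleftrightarrow> t / u > t / s" using True assms by (intro ln_less_cancel_iff) auto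
    also have "\<dots> \<longleftrightarrow> u < s" using True assms by (auto simp: field_simps)
    finally show ?thesis ..
  qed
  have "ln (s / u) = ln (t / u) - ?\<delta>" using True assms by (simp add: ln_div)
  also have "\<dots> = ?\<delta> * (?x - 1)" using \<delta> by (simp add: right_diff_distrib)
  finally have lsu: "ln (s / u) = ?\<delta> * (?x - 1)" .
  have "hadamard_kernel h t u = ?\<delta> powr h * ?x powr h"
    using True x \<delta> powr_mult[of ?\<delta> ?x h] by (simp add: hadamard_kernel_def)
  moreover have "hadamard_kernel h s u = ?\<delta> powr h * (if ?x > 1 then (?x - 1) powr h else 0)"
  proof (cases "u < s")
    case u: True
    then have "(?\<delta> * (?x - 1)) powr h = ?\<delta> powr h * (?x - 1) powr h"
      using us \<delta> by (intro powr_mult)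
    then show ?thesis using u us True lsu by (simp add: hadamard_kernel_def)
  next
    case False
    then show ?thesis using us by (simp add: hadamard_kernel_def)
  qed
  ultimately have "(hadamard_kernel h t u - hadamard_kernel h s u)\<^sup>2 =
     (?\<delta> powr h)\<^sup>2 * hadamard_weight h ?x"
    by (simp add: hadamard_weight_def right_diff_distrib[symmetric] power_mult_distrib)
  also have "(?\<delta> powr h)\<^sup>2 = ?\<delta> powr (2 * h)"
    using \<delta> by (simp add: power2_eq_square flip: powr_add)
  finally show ?thesis using True by simp
qed (use assms in \<open>auto simp: hadamard_kernel_def\<close>)

text \<open>
  The variance of the increment over \<open>[s, t]\<close>, up to the factor \<open>Gamma (2 h + 1)\<close>. Apart from the
  factor \<open>t\<close> it depends only on the ratio \<open>t / s\<close>, which is how the self-similarity of the process enters.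
\<close>

lemma nn_integral_hadamard_kernel_diff:
  assumes "- 1 / 2 < h" "h < 0" "0 < s" "s < t"
  shows "(\<integral>\<^sup>+ u. ennreal ((hadamard_kernel h t u - hadamard_kernel h s u)\<^sup>2) \<partial>lborel) =
    ennreal (t * ln (t / s) powr (2 * h + 1) * hadamard_weight_laplace h (ln (t / s)))"
proof -
  let ?\<delta> = "ln (t / s)"
  have \<delta>: "?\<delta> > 0" using assms by simp
  have "(\<integral>\<^sup>+ u. ennreal ((hadamard_kernel h t u - hadamard_kernel h s u)\<^sup>2) \<partial>lborel) =
      (\<integral>\<^sup>+ u. ennreal (?\<delta> powr (2 * h)) * (ennreal (hadamard_weight h (ln (t / u) / ?\<delta>)) * indicator {0<..<t} u) \<partial>lborel)"
    using \<delta> by (intro nn_integral_cong)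
      (simp add: hadamard_kernel_diff_square[OF assms(3,4)] hadamard_weight_def ennreal_mult'' mult.assoc ennreal_indicator)
  also have "\<dots> = ennreal (?\<delta> powr (2 * h)) * (\<integral>\<^sup>+ u \<in> {0<..<t}. ennreal (hadamard_weight h (ln (t / u) / ?\<delta>)) \<partial>lborel)"
    by (intro nn_integral_cmult) measurable
  also have "(\<integral>\<^sup>+ u \<in> {0<..<t}. ennreal (hadamard_weight h (ln (t / u) / ?\<delta>)) \<partial>lborel) =
      ennreal (t * ?\<delta> * hadamard_weight_laplace h ?\<delta>)"
    unfolding hadamard_weight_laplace_def using assms \<delta>
    by (intro nn_integral_log_substitution hadamard_weight_discounted_integrable) (auto simp: hadamard_weight_def)
  also have "ennreal (?\<delta> powr (2 * h)) * ennreal (t * ?\<delta> * hadamard_weight_laplace h ?\<delta>) =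
      ennreal (t * (?\<delta> powr (2 * h) * ?\<delta> powr 1) * hadamard_weight_laplace h ?\<delta>)"
    using \<delta> by (simp add: ennreal_mult'[symmetric] mult_ac)
  finally show ?thesis by (simp only: powr_add)
qed

text \<open>
  The variance at time \<open>t\<close>, which is the Gamma integral after the logarithmic substitution. It is
  needed for the first interval of the grid, where \<open>ln (t / s)\<close> makes no sense because \<open>s = 0\<close>.
\<close>

lemma nn_integral_hadamard_kernel:
  assumes "- 1 / 2 < h" "0 < t"
  shows "(\<integral>\<^sup>+ u. ennreal ((hadamard_kernel h t u)\<^sup>2) \<partial>lborel) = ennreal (t * Gamma (2 * h + 1))"
proof -
  have "((\<lambda>x. x powr (2 * h + 1 - 1) / exp x) has_integral Gamma (2 * h + 1)) {0..}"
    using Gamma_integral_real[of "2 * h + 1"] assms by simp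
  then have "((\<lambda>x. x powr (2 * h) * exp (- (1 * x))) has_integral Gamma (2 * h + 1)) {0..}"
    by (simp add: exp_minus divide_inverse)
  \<comment> \<open>The integrand vanishes at \<open>0\<close>, where \<open>0 powr _ = 0\<close>.\<close>
  moreover have "{x \<in> {0..} - {0<..}. x powr (2 * h) * exp (- (1 * x)) \<noteq> 0} = {}"
    and "{x \<in> {0<..} - {0..}. x powr (2 * h) * exp (- (1 * x)) \<noteq> 0} = {}"
    by auto
  ultimately have G: "((\<lambda>x. x powr (2 * h) * exp (- (1 * x))) has_integral Gamma (2 * h + 1)) {0<..}"
    by (subst has_integral_spike_set_eq[of "{0<..}" "{0..}"]) (simp_all only: negligible_empty)
  then have "(\<lambda>x. x powr (2 * h) * exp (- (1 * x))) absolutely_integrable_on {0<..}"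
    by (intro nonnegative_absolutely_integrable_1) auto
  then have int: "set_integrable lborel {0<..} (\<lambda>x. x powr (2 * h) * exp (- (1 * x)))"
    by (simp add: set_integrable_def integrable_completion)
  have "(\<integral>\<^sup>+ u. ennreal ((hadamard_kernel h t u)\<^sup>2) \<partial>lborel) =
      (\<integral>\<^sup>+ u \<in> {0<..<t}. ennreal ((ln (t / u) / 1) powr (2 * h)) \<partial>lborel)"
    by (intro nn_integral_cong)
      (auto simp: hadamard_kernel_def indicator_def power2_eq_square simp flip: powr_add)
  also have "\<dots> = ennreal (t * 1 * (LBINT x:{0<..}. x powr (2 * h) * exp (- (1 * x))))"
    using assms int by (intro nn_integral_log_substitution) auto
  also have "(LBINT x:{0<..}. x powr (2 * h) * exp (- (1 * x))) = Gamma (2 * h + 1)"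
    using set_borel_integral_eq_integral(2)[OF int] G by (simp add: integral_unique)
  finally show ?thesis by simp
qed

section \<open>Increments of Hadamard fractional Brownian motion\<close>

lemma step_fun_eq_0:
  assumes "is_step a b \<phi>" "s \<notin> {a<..b}"
  shows "step_fun \<phi> s = 0"
proof -
  have "map (\<lambda>(c, u, v). c * indicator {u<..v} s) \<phi> = map (\<lambda>_. 0) \<phi>"
    using assms by (intro map_cong) (auto simp: is_step_def indicator_def)
  then show ?thesis by (simp only: step_fun_def sum_list_0)
qed

text \<open>
  Extending the kernel by \<open>0\<close> outside \<open>(0, t)\<close> makes approximations for different times comparable,
  because they then all live in \<open>L\<^sup>2\<close> of the whole line. Time \<open>0\<close> fits in with the empty step
  function, so that increments starting at time \<open>0\<close> need no approximation of their own.
\<close>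

lemma hadamard_fBm_step_approx:
  assumes X: "hadamard_fBm M B \<alpha> X" and "0 < \<alpha>" "0 \<le> t"
  shows "\<exists>\<phi>. (\<forall>n. is_step 0 t (\<phi> n)) \<and>
    (\<lambda>n. \<integral>\<^sup>+ s. ennreal ((hadamard_kernel ((\<alpha> - 1) / 2) t s - step_fun (\<phi> n) s)\<^sup>2) \<partial>lborel) \<longlonglongrightarrow> 0 \<and>
    (\<lambda>n. \<integral>\<^sup>+ \<omega>. ennreal ((sqrt (Gamma \<alpha>) * X t \<omega> - step_integral B (\<phi> n) \<omega>)\<^sup>2) \<partial>M) \<longlonglongrightarrow> 0"
proof (cases "t = 0")
  case True
  have "AE \<omega> in M. X 0 \<omega> = 0" using X by (simp add: hadamard_fBm_def)
  then have "(\<integral>\<^sup>+ \<omega>. ennreal ((sqrt (Gamma \<alpha>) * X 0 \<omega> - step_integral B [] \<omega>)\<^sup>2) \<partial>M) = (\<integral>\<^sup>+ \<omega>. 0 \<partial>M)"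
    by (intro nn_integral_cong_AE, eventually_elim) (simp add: step_integral_def)
  then show ?thesis using True
    by (intro exI[of _ "\<lambda>_. []"]) (simp add: is_step_def hadamard_kernel_def step_fun_def)
next
  case False
  then have t: "t > 0" using assms by simp
  let ?f = "\<lambda>s. ln (t / s) powr ((\<alpha> - 1) / 2)"
  obtain Y where Y: "has_wiener_integral M B 0 t ?f Y"
    and XY: "AE \<omega> in M. X t \<omega> = 1 / sqrt (Gamma \<alpha>) * Y \<omega>"
    using X t unfolding hadamard_fBm_def by blast
  then obtain \<phi> where \<phi>: "\<And>n. is_step 0 t (\<phi> n)"
    and 1: "(\<lambda>n. \<integral>\<^sup>+ s \<in> {0<..<t}. ennreal ((?f s - step_fun (\<phi> n) s)\<^sup>2) \<partial>lborel) \<longlonglongrightarrow> 0"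
    and 2: "(\<lambda>n. \<integral>\<^sup>+ \<omega>. ennreal ((Y \<omega> - step_integral B (\<phi> n) \<omega>)\<^sup>2) \<partial>M) \<longlonglongrightarrow> 0"
    unfolding has_wiener_integral_def by blast
  have "(\<integral>\<^sup>+ s. ennreal ((hadamard_kernel ((\<alpha> - 1) / 2) t s - step_fun (\<phi> n) s)\<^sup>2) \<partial>lborel) =
      (\<integral>\<^sup>+ s \<in> {0<..<t}. ennreal ((?f s - step_fun (\<phi> n) s)\<^sup>2) \<partial>lborel)" for n
    \<comment> \<open>A step function on \<open>(0, t]\<close> may be non-zero at \<open>t\<close>, where the kernel vanishes.\<close>
    using AE_lborel_singleton[of t]
    by (intro nn_integral_cong_AE, eventually_elim)
      (auto simp: hadamard_kernel_def indicator_def step_fun_eq_0[OF \<phi>])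
  moreover have "(\<integral>\<^sup>+ \<omega>. ennreal ((sqrt (Gamma \<alpha>) * X t \<omega> - step_integral B (\<phi> n) \<omega>)\<^sup>2) \<partial>M) =
      (\<integral>\<^sup>+ \<omega>. ennreal ((Y \<omega> - step_integral B (\<phi> n) \<omega>)\<^sup>2) \<partial>M)" for n
    using XY by (intro nn_integral_cong_AE, eventually_elim)
      (use Gamma_real_pos[OF \<open>0 < \<alpha>\<close>] in simp)
  ultimately show ?thesis using \<phi> 1 2 by (intro exI[of _ \<phi>]) simp
qed

lemma nn_integral_square_diff_tendsto:
  fixes f f' :: "'b \<Rightarrow> real" and g g' :: "nat \<Rightarrow> 'b \<Rightarrow> real"
  assumes [measurable]: "f \<in> borel_measurable N" "f' \<in> borel_measurable N"
      "\<And>n. g n \<in> borel_measurable N" "\<And>n. g' n \<in> borel_measurable N"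
    and 1: "(\<lambda>n. \<integral>\<^sup>+ x. ennreal ((f x - g n x)\<^sup>2) \<partial>N) \<longlonglongrightarrow> 0"
    and 2: "(\<lambda>n. \<integral>\<^sup>+ x. ennreal ((f' x - g' n x)\<^sup>2) \<partial>N) \<longlonglongrightarrow> 0"
  shows "(\<lambda>n. \<integral>\<^sup>+ x. ennreal (((f x - f' x) - (g n x - g' n x))\<^sup>2) \<partial>N) \<longlonglongrightarrow> 0"
proof (rule tendsto_sandwich[OF _ _ tendsto_const])
  let ?U = "\<lambda>n. 2 * (\<integral>\<^sup>+ x. ennreal ((f x - g n x)\<^sup>2) \<partial>N) + 2 * (\<integral>\<^sup>+ x. ennreal ((f' x - g' n x)\<^sup>2) \<partial>N)"
  have "?U \<longlonglongrightarrow> 2 * 0 + 2 * 0"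
    by (intro tendsto_add ennreal_tendsto_cmult 1 2) auto
  then show "?U \<longlonglongrightarrow> 0" by simp
  show "eventually (\<lambda>n. (\<integral>\<^sup>+ x. ennreal (((f x - f' x) - (g n x - g' n x))\<^sup>2) \<partial>N) \<le> ?U n) sequentially"
  proof (intro always_eventually allI)
    fix n
    have pw: "((f x - f' x) - (g n x - g' n x))\<^sup>2 \<le> 2 * (f x - g n x)\<^sup>2 + 2 * (f' x - g' n x)\<^sup>2" for x
    proof -
      have "0 \<le> ((f x - g n x) + (f' x - g' n x))\<^sup>2" by simp
      then show ?thesis by (simp add: power2_eq_square algebra_simps)
    qed
    have "(\<integral>\<^sup>+ x. ennreal (((f x - f' x) - (g n x - g' n x))\<^sup>2) \<partial>N) \<le>
        (\<integral>\<^sup>+ x. 2 * ennreal ((f x - g n x)\<^sup>2) + 2 * ennreal ((f' x - g' n x)\<^sup>2) \<partial>N)"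
    proof (rule nn_integral_mono)
      fix x
      have "2 * ennreal ((f x - g n x)\<^sup>2) + 2 * ennreal ((f' x - g' n x)\<^sup>2) =
          ennreal (2 * (f x - g n x)\<^sup>2 + 2 * (f' x - g' n x)\<^sup>2)"
        by (simp add: ennreal_plus ennreal_mult)
      then show "ennreal (((f x - f' x) - (g n x - g' n x))\<^sup>2) \<le>
          2 * ennreal ((f x - g n x)\<^sup>2) + 2 * ennreal ((f' x - g' n x)\<^sup>2)"
        using pw[of x] by (simp only: ennreal_leI)
    qed
    also have "\<dots> = ?U n"
      by (subst nn_integral_add) (auto simp: nn_integral_cmult)
    finally show "(\<integral>\<^sup>+ x. ennreal (((f x - f' x) - (g n x - g' n x))\<^sup>2) \<partial>N) \<le> ?U n" .
  qed
qed auto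

definition step_diff ::
    "(real \<times> real \<times> real) list \<Rightarrow> (real \<times> real \<times> real) list \<Rightarrow> (real \<times> real \<times> real) list" where
  "step_diff \<phi> \<psi> = \<phi> @ map (\<lambda>(c, u, v). (- c, u, v)) \<psi>"

lemma step_diff_simps:
  shows step_fun_step_diff: "step_fun (step_diff \<phi> \<psi>) s = step_fun \<phi> s - step_fun \<psi> s"
    and step_integral_step_diff:
      "step_integral B (step_diff \<phi> \<psi>) \<omega> = step_integral B \<phi> \<omega> - step_integral B \<psi> \<omega>"
proof -
  have "step_fun (map (\<lambda>(c, u, v). (- c, u, v)) \<psi>) s = - step_fun \<psi> s"
    by (induction \<psi>) (auto simp: step_fun_def)
  then show "step_fun (step_diff \<phi> \<psi>) s = step_fun \<phi> s - step_fun \<psi> s"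
    by (simp add: step_diff_def step_fun_def)
  have "step_integral B (map (\<lambda>(c, u, v). (- c, u, v)) \<psi>) \<omega> = - step_integral B \<psi> \<omega>"
    by (induction \<psi>) (auto simp: step_integral_def)
  then show "step_integral B (step_diff \<phi> \<psi>) \<omega> = step_integral B \<phi> \<omega> - step_integral B \<psi> \<omega>"
    by (simp add: step_diff_def step_integral_def)
qed

lemma is_step_step_diff:
  assumes "is_step a b \<phi>" "is_step a b' \<psi>" "b' \<le> b"
  shows "is_step a b (step_diff \<phi> \<psi>)"
  using assms by (fastforce simp: is_step_def step_diff_def)

text \<open>
  The difference of the approximating step functions for the times \<open>t\<close> and \<open>s\<close> approximates the
  difference of the kernels, so the increment is a centered Gaussian variable of variance \<open>V\<close>.
\<close>

lemma (in standard_brownian_motion) hadamard_increment_moment: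
  assumes X: "hadamard_fBm M B \<alpha> X" and "0 < \<alpha>" "0 \<le> s" "s < t" "0 < p" "0 < V"
    and V: "(\<integral>\<^sup>+ u. ennreal ((hadamard_kernel ((\<alpha> - 1) / 2) t u - hadamard_kernel ((\<alpha> - 1) / 2) s u)\<^sup>2)
              \<partial>lborel) = ennreal (Gamma \<alpha> * V)"
  shows "(\<integral>\<^sup>+ \<omega>. ennreal (\<bar>X t \<omega> - X s \<omega>\<bar> powr p) \<partial>M) = ennreal (gauss_abs_moment p * V powr (p / 2))"
proof -
  let ?K = "hadamard_kernel ((\<alpha> - 1) / 2)" and ?c = "sqrt (Gamma \<alpha>)"
  have G: "Gamma \<alpha> > 0" using assms by (intro Gamma_real_pos)
  have [measurable]: "X t \<in> borel_measurable M" "X s \<in> borel_measurable M"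
    using X assms by (auto simp: hadamard_fBm_def)
  obtain \<phi> where \<phi>: "\<And>n. is_step 0 t (\<phi> n)"
    "(\<lambda>n. \<integral>\<^sup>+ u. ennreal ((?K t u - step_fun (\<phi> n) u)\<^sup>2) \<partial>lborel) \<longlonglongrightarrow> 0"
    "(\<lambda>n. \<integral>\<^sup>+ \<omega>. ennreal ((?c * X t \<omega> - step_integral B (\<phi> n) \<omega>)\<^sup>2) \<partial>M) \<longlonglongrightarrow> 0"
    using hadamard_fBm_step_approx[OF X \<open>0 < \<alpha>\<close>, of t] assms by auto
  obtain \<psi> where \<psi>: "\<And>n. is_step 0 s (\<psi> n)"
    "(\<lambda>n. \<integral>\<^sup>+ u. ennreal ((?K s u - step_fun (\<psi> n) u)\<^sup>2) \<partial>lborel) \<longlonglongrightarrow> 0"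
    "(\<lambda>n. \<integral>\<^sup>+ \<omega>. ennreal ((?c * X s \<omega> - step_integral B (\<psi> n) \<omega>)\<^sup>2) \<partial>M) \<longlonglongrightarrow> 0"
    using hadamard_fBm_step_approx[OF X \<open>0 < \<alpha>\<close> \<open>0 \<le> s\<close>] by auto
  have int: "integrable lborel (\<lambda>u. (?K t u - ?K s u)\<^sup>2)"
    using V by (auto simp: integrable_iff_bounded)
  have LV: "(LINT u|lborel. (?K t u - ?K s u)\<^sup>2) = Gamma \<alpha> * V"
    using V G \<open>0 < V\<close> by (simp add: integral_eq_nn_integral)
  let ?Z = "\<lambda>\<omega>. ?c * X t \<omega> - ?c * X s \<omega>"
  have charZ: "char (distr M borel ?Z) \<theta> = exp (- (\<theta>\<^sup>2 / 2 * (Gamma \<alpha> * V)))" for \<theta>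
    unfolding LV[symmetric]
  proof (rule step_limit_gaussian)
    show "integrable lborel (\<lambda>u. (?K t u - ?K s u)\<^sup>2)" by (rule int)
    show "is_step 0 t (step_diff (\<phi> n) (\<psi> n))" for n
      using \<phi>(1) \<psi>(1) assms by (intro is_step_step_diff) auto
    show "(\<lambda>n. \<integral>\<^sup>+ u. ennreal ((?K t u - ?K s u - step_fun (step_diff (\<phi> n) (\<psi> n)) u)\<^sup>2) \<partial>lborel) \<longlonglongrightarrow> 0"
      unfolding step_fun_step_diff using \<phi>(2) \<psi>(2)
      by (intro nn_integral_square_diff_tendsto) auto
    show "(\<lambda>n. \<integral>\<^sup>+ \<omega>. ennreal ((?Z \<omega> - step_integral B (step_diff (\<phi> n) (\<psi> n)) \<omega>)\<^sup>2) \<partial>M) \<longlonglongrightarrow> 0"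
      unfolding step_integral_step_diff using \<phi>(3) \<psi>(3)
        borel_measurable_step_integral[OF \<phi>(1)] borel_measurable_step_integral[OF \<psi>(1)]
      by (intro nn_integral_square_diff_tendsto) auto
  qed auto
  have "char (distr M borel (\<lambda>\<omega>. X t \<omega> - X s \<omega>)) \<theta> = exp (- (\<theta>\<^sup>2 / 2 * V))" for \<theta>
  proof -
    have "char (distr M borel (\<lambda>\<omega>. X t \<omega> - X s \<omega>)) \<theta> = char (distr M borel ?Z) (\<theta> / ?c)"
      using G by (simp add: char_def integral_distr right_diff_distrib[symmetric] del: of_real_diff)
    then show ?thesis using G by (simp add: charZ power_divide)
  qed
  then show ?thesis using assms by (intro gaussian_abs_moment) auto
qed

section \<open>Asymptotics of the expected variation\<close>

text \<open>
  A Stolz--Cesaro argument: the increments \<open>D k\<close> of \<open>n powr (q + 1)\<close> are asymptotic to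
  \<open>(q + 1) k powr q\<close>, so \<open>a k / D k\<close> tends to \<open>L = c / (q + 1)\<close>, and the \<open>D k\<close> telescope. The terms
  before the asymptotics sets in contribute a constant \<open>C\<close>, which is negligible.
\<close>

lemma sum_asymp_powr:
  fixes a :: "nat \<Rightarrow> real"
  assumes q: "0 < q" and lim: "(\<lambda>k. a k / real k powr q) \<longlonglongrightarrow> c"
  shows "(\<lambda>n. (\<Sum>k=1..n. a k) / real n powr (q + 1)) \<longlonglongrightarrow> c / (q + 1)"
proof -
  define L where "L = c / (q + 1)"
  define D where "D n = real n powr (q + 1) - (real n - 1) powr (q + 1)" for n :: nat
  have "(\<lambda>n::nat. real n powr q / D n) \<longlonglongrightarrow> 1 / (q + 1)"
    unfolding D_def using q by (real_asymp simp: inverse_eq_divide add.commute)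
  from tendsto_mult[OF lim this]
  have "(\<lambda>n. a n / real n powr q * (real n powr q / D n)) \<longlonglongrightarrow> L"
    by (simp add: L_def)
  then have lim': "(\<lambda>n. a n / D n) \<longlonglongrightarrow> L"
    by (rule Lim_transform_eventually) (rule eventually_sequentiallyI[of 1], simp)
  have Dpos: "D n > 0" if "n \<ge> 1" for n
    using that q by (auto simp: D_def intro!: powr_less_mono2)
  have sumD: "(\<Sum>k=1..n. D k) = real n powr (q + 1)" for n
    by (induction n) (auto simp: D_def)
  show ?thesis unfolding L_def[symmetric]
  proof (rule LIMSEQ_I)
    fix r :: real assume r: "r > 0"
    obtain N where N: "\<And>n. n \<ge> N \<Longrightarrow> \<bar>a n / D n - L\<bar> < r / 2"
      using LIMSEQ_D[OF lim', of "r / 2"] r by auto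
    define C where "C = (\<Sum>k=1..N. \<bar>a k - L * D k\<bar>)"
    have C0: "C \<ge> 0" by (simp add: C_def)
    have termwise: "\<bar>a k - L * D k\<bar> \<le> (if k \<le> N then \<bar>a k - L * D k\<bar> else 0) + r / 2 * D k" if "k \<ge> 1" for k
    proof (cases "k \<le> N")
      case False
      have "\<bar>a k - L * D k\<bar> = \<bar>a k / D k - L\<bar> * D k"
        using Dpos[OF that] by (simp add: abs_mult[symmetric] field_simps flip: abs_mult_pos)
      also have "\<dots> \<le> r / 2 * D k"
        using N[of k] False Dpos[OF that] by (intro mult_right_mono) auto
      finally show ?thesis using False by simp
    qed (use r Dpos[OF that] in auto)
    have bound: "\<bar>(\<Sum>k=1..n. a k) - L * real n powr (q + 1)\<bar> \<le> C + r / 2 * real n powr (q + 1)" for n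
    proof -
      have "\<bar>(\<Sum>k=1..n. a k) - L * real n powr (q + 1)\<bar> = \<bar>\<Sum>k=1..n. a k - L * D k\<bar>"
        by (simp add: sumD[symmetric] sum_subtractf sum_distrib_left)
      also have "\<dots> \<le> (\<Sum>k=1..n. \<bar>a k - L * D k\<bar>)" by (rule sum_abs)
      also have "\<dots> \<le> (\<Sum>k=1..n. (if k \<le> N then \<bar>a k - L * D k\<bar> else 0) + r / 2 * D k)"
        by (intro sum_mono termwise) auto
      also have "\<dots> = (\<Sum>k\<in>{1..n} \<inter> {..N}. \<bar>a k - L * D k\<bar>) + r / 2 * real n powr (q + 1)"
        unfolding sum.distrib sum_distrib_left[symmetric] sumD
        by (subst sum.inter_restrict) simp_all
      also have "(\<Sum>k\<in>{1..n} \<inter> {..N}. \<bar>a k - L * D k\<bar>) \<le> C"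
        unfolding C_def by (intro sum_mono2) auto
      finally show ?thesis by simp
    qed
    have "(\<lambda>n::nat. C / real n powr (q + 1)) \<longlonglongrightarrow> 0"
      using q by real_asymp
    then have "eventually (\<lambda>n::nat. C / real n powr (q + 1) < r / 2) sequentially"
      using r by (intro order_tendstoD(2)[where y=0]) auto
    moreover have "eventually (\<lambda>n::nat. n \<ge> 1) sequentially" by (rule eventually_ge_at_top)
    ultimately have "eventually (\<lambda>n. norm ((\<Sum>k=1..n. a k) / real n powr (q + 1) - L) < r) sequentially"
    proof eventually_elim
      case (elim n)
      let ?m = "real n powr (q + 1)"
      have m: "?m > 0" using elim by simp
      have "(\<Sum>k=1..n. a k) / ?m - L = ((\<Sum>k=1..n. a k) - L * ?m) / ?m"
        using m by (subst diff_divide_distrib) simp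
      then have "\<bar>(\<Sum>k=1..n. a k) / ?m - L\<bar> = \<bar>(\<Sum>k=1..n. a k) - L * ?m\<bar> / ?m"
        using m by (simp only: abs_divide abs_of_pos)
      also have "\<dots> \<le> (C + r / 2 * ?m) / ?m"
        using m bound[of n] by (intro divide_right_mono) auto
      also have "\<dots> = C / ?m + r / 2" using m by (simp add: field_simps)
      also have "\<dots> < r" using elim by linarith
      finally show ?case by simp
    qed
    then show "\<exists>no. \<forall>n\<ge>no. norm ((\<Sum>k=1..n. a k) / real n powr (q + 1) - L) < r"
      by (simp add: eventually_sequentially)
  qed
qed

text \<open>
  The variance of the increment over \<open>[k - 1, k]\<close>. Self-similarity reduces every interval of the
  uniform grid to this case. The index \<open>0\<close> has no meaning, and the value \<open>1\<close> there keeps all values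
  positive.
\<close>

definition unit_increment_variance :: "real \<Rightarrow> nat \<Rightarrow> real" where
  "unit_increment_variance \<alpha> k =
    (if k \<le> 1 then 1
     else real k * ln (real k / (real k - 1)) powr \<alpha> *
       hadamard_weight_laplace ((\<alpha> - 1) / 2) (ln (real k / (real k - 1))) / Gamma \<alpha>)"

lemma unit_increment_variance_pos:
  assumes "0 < \<alpha>" "\<alpha> < 1"
  shows "0 < unit_increment_variance \<alpha> k"
proof (cases "k \<le> 1")
  case False
  then have "ln (real k / (real k - 1)) > 0" by simp
  then show ?thesis
    using assms False hadamard_weight_laplace_pos[of "(\<alpha> - 1) / 2" "ln (real k / (real k - 1))"]
    by (simp add: unit_increment_variance_def Gamma_real_pos)
qed (simp add: unit_increment_variance_def)

lemma nn_integral_hadamard_grid: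
  assumes "0 < \<alpha>" "\<alpha> < 1" "0 < a" "1 \<le> k"
  shows "(\<integral>\<^sup>+ u. ennreal ((hadamard_kernel ((\<alpha> - 1) / 2) (a * real k) u -
      hadamard_kernel ((\<alpha> - 1) / 2) (a * (real k - 1)) u)\<^sup>2) \<partial>lborel) =
    ennreal (Gamma \<alpha> * (a * unit_increment_variance \<alpha> k))"
proof (cases "k = 1")
  case True
  have "hadamard_kernel ((\<alpha> - 1) / 2) 0 u = 0" for u by (simp add: hadamard_kernel_def)
  then show ?thesis
    using True nn_integral_hadamard_kernel[of "(\<alpha> - 1) / 2" a] assms
    by (simp add: unit_increment_variance_def mult.commute diff_divide_distrib)
next
  case False
  then have k: "real k > 1" using assms by simp
  have "a * real k / (a * (real k - 1)) = real k / (real k - 1)" "2 * ((\<alpha> - 1) / 2) + 1 = \<alpha>"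
    using assms k by (simp_all add: diff_divide_distrib)
  then show ?thesis
    using nn_integral_hadamard_kernel_diff[of "(\<alpha> - 1) / 2" "a * (real k - 1)" "a * real k"] assms k
      less_imp_neq[OF Gamma_real_pos[OF \<open>0 < \<alpha>\<close>]]
    by (simp add: unit_increment_variance_def mult.assoc)
qed

text \<open>
  Since \<open>k ln (k / (k - 1))\<close> tends to \<open>1\<close>, the variance is asymptotic to \<open>k powr (1 - \<alpha>)\<close> times the
  total mass of the weight, divided by \<open>Gamma \<alpha>\<close>.
\<close>

lemma unit_increment_variance_asymp:
  assumes "0 < \<alpha>" "\<alpha> < 1"
  shows "(\<lambda>k. unit_increment_variance \<alpha> k / real k powr (1 - \<alpha>))
    \<longlonglongrightarrow> hadamard_weight_laplace ((\<alpha> - 1) / 2) 0 / Gamma \<alpha>"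
proof -
  let ?d = "\<lambda>k::nat. ln (real k / (real k - 1))"
  have d0: "?d \<longlonglongrightarrow> 0" by real_asymp
  have dpos: "0 \<le> ?d k" for k
  proof -
    consider "k = 0" | "k = 1" | "k \<ge> 2" by linarith
    then show ?thesis by cases auto
  qed
  have G: "Gamma \<alpha> \<noteq> 0" using Gamma_real_pos[OF \<open>0 < \<alpha>\<close>] by simp
  have "(\<lambda>k. real k * ?d k) \<longlonglongrightarrow> 1" by real_asymp
  then have "(\<lambda>k. (real k * ?d k) powr \<alpha>) \<longlonglongrightarrow> 1 powr \<alpha>"
    by (intro tendsto_powr tendsto_const) auto
  from tendsto_mult[OF this hadamard_weight_laplace_tendsto[OF _ _ dpos d0, of "(\<alpha> - 1) / 2"]]
  have "(\<lambda>k. (real k * ?d k) powr \<alpha> * hadamard_weight_laplace ((\<alpha> - 1) / 2) (?d k) / Gamma \<alpha>)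
      \<longlonglongrightarrow> 1 powr \<alpha> * hadamard_weight_laplace ((\<alpha> - 1) / 2) 0 / Gamma \<alpha>"
    using assms G by (intro tendsto_divide tendsto_const) auto
  then have "(\<lambda>k. (real k * ?d k) powr \<alpha> * hadamard_weight_laplace ((\<alpha> - 1) / 2) (?d k) / Gamma \<alpha>)
      \<longlonglongrightarrow> hadamard_weight_laplace ((\<alpha> - 1) / 2) 0 / Gamma \<alpha>"
    by (simp only: powr_one_eq_one mult_1)
  then show ?thesis
  proof (rule Lim_transform_eventually)
    have "(real k * ?d k) powr \<alpha> * hadamard_weight_laplace ((\<alpha> - 1) / 2) (?d k) / Gamma \<alpha> =
        unit_increment_variance \<alpha> k / real k powr (1 - \<alpha>)" if "2 \<le> k" for k
    proof -
      have e: "real k powr \<alpha> = real k / real k powr (1 - \<alpha>)"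
        using that by (simp add: powr_diff)
      have "(real k * ?d k) powr \<alpha> = real k powr \<alpha> * ?d k powr \<alpha>"
        using that by (intro powr_mult)
      then show ?thesis using that
        by (simp add: unit_increment_variance_def e mult_ac)
    qed
    then show "eventually (\<lambda>k. (real k * ?d k) powr \<alpha> * hadamard_weight_laplace ((\<alpha> - 1) / 2) (?d k) / Gamma \<alpha> =
        unit_increment_variance \<alpha> k / real k powr (1 - \<alpha>)) sequentially"
      by (rule eventually_sequentiallyI)
  qed
qed

lemma (in standard_brownian_motion) hadamard_expected_variation:
  assumes X: "hadamard_fBm M B \<alpha> X" and \<alpha>: "0 < \<alpha>" "\<alpha> < 1" and "0 < T" "0 < p" "1 \<le> n"
  shows "(\<integral>\<^sup>+ \<omega>. ennreal (\<Sum>k = 1..n.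
      \<bar>X (T * real k / real n) \<omega> - X (T * (real k - 1) / real n) \<omega>\<bar> powr p) \<partial>M) =
    ennreal (gauss_abs_moment p * (T / real n) powr (p / 2) *
      (\<Sum>k = 1..n. unit_increment_variance \<alpha> k powr (p / 2)))"
proof -
  let ?D = "\<lambda>k \<omega>. \<bar>X (T * real k / real n) \<omega> - X (T * (real k - 1) / real n) \<omega>\<bar> powr p"
  have meas: "X t \<in> borel_measurable M" if "0 \<le> t" for t
    using X that by (simp add: hadamard_fBm_def)
  have D [measurable]: "?D k \<in> borel_measurable M" if "k \<in> {1..n}" for k
  proof -
    have [measurable]: "X (T * real k / real n) \<in> borel_measurable M"
      "X (T * (real k - 1) / real n) \<in> borel_measurable M"
      using that assms by (auto intro!: meas)
    show ?thesis by measurable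
  qed
  have moment: "(\<integral>\<^sup>+ \<omega>. ennreal (?D k \<omega>) \<partial>M) =
      ennreal (gauss_abs_moment p * (T / real n) powr (p / 2) * unit_increment_variance \<alpha> k powr (p / 2))"
    if k: "k \<in> {1..n}" for k
  proof -
    let ?a = "T / real n"
    have a: "?a > 0" using assms by simp
    have "(\<integral>\<^sup>+ \<omega>. ennreal (\<bar>X (?a * real k) \<omega> - X (?a * (real k - 1)) \<omega>\<bar> powr p) \<partial>M) =
        ennreal (gauss_abs_moment p * (?a * unit_increment_variance \<alpha> k) powr (p / 2))"
    proof (rule hadamard_increment_moment[OF X])
      show "0 \<le> ?a * (real k - 1)" using k a by (intro mult_nonneg_nonneg) auto
      show "?a * (real k - 1) < ?a * real k" using a by (intro mult_strict_left_mono) auto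
      show "0 < ?a * unit_increment_variance \<alpha> k"
        using a unit_increment_variance_pos[OF \<alpha>] by (rule mult_pos_pos)
      show "(\<integral>\<^sup>+ u. ennreal ((hadamard_kernel ((\<alpha> - 1) / 2) (?a * real k) u -
          hadamard_kernel ((\<alpha> - 1) / 2) (?a * (real k - 1)) u)\<^sup>2) \<partial>lborel) =
        ennreal (Gamma \<alpha> * (?a * unit_increment_variance \<alpha> k))"
        using k by (intro nn_integral_hadamard_grid \<alpha> a) auto
    qed (use \<alpha> \<open>0 < p\<close> in auto)
    then show ?thesis
      using powr_mult[of ?a "unit_increment_variance \<alpha> k" "p / 2"] by (simp add: mult.assoc)
  qed
  have "(\<integral>\<^sup>+ \<omega>. ennreal (\<Sum>k = 1..n. ?D k \<omega>) \<partial>M) = (\<integral>\<^sup>+ \<omega>. (\<Sum>k = 1..n. ennreal (?D k \<omega>)) \<partial>M)"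
    by (simp add: sum_ennreal)
  also have "\<dots> = (\<Sum>k = 1..n. \<integral>\<^sup>+ \<omega>. ennreal (?D k \<omega>) \<partial>M)"
    using D by (intro nn_integral_sum) auto
  also have "\<dots> = (\<Sum>k = 1..n. ennreal (gauss_abs_moment p * (T / real n) powr (p / 2) *
      unit_increment_variance \<alpha> k powr (p / 2)))"
    by (intro sum.cong refl moment)
  also have "\<dots> = ennreal (\<Sum>k = 1..n. gauss_abs_moment p * (T / real n) powr (p / 2) *
      unit_increment_variance \<alpha> k powr (p / 2))"
    using nn_integral_gauss_abs_moment(2)[OF \<open>0 < p\<close>] by (intro sum_ennreal) auto
  finally show ?thesis by (simp only: sum_distrib_left)
qed

text \<open>
  The scaling factor contributes \<open>n powr (- p / 2)\<close> and the sum of the powers of the variances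
  \<open>n powr ((1 - \<alpha>) p / 2 + 1)\<close>; the exponents add up to \<open>1 - \<alpha> p / 2\<close>, which changes sign at
  the critical value \<open>p = 2 / \<alpha>\<close>.
\<close>

lemma hadamard_scaled_variation_asymp:
  assumes \<alpha>: "0 < \<alpha>" "\<alpha> < 1" and "0 < T" "0 < p"
  shows "\<exists>L>0. \<exists>r. r \<longlonglongrightarrow> L \<and> (\<forall>n\<ge>1. gauss_abs_moment p * (T / real n) powr (p / 2) *
      (\<Sum>k = 1..n. unit_increment_variance \<alpha> k powr (p / 2)) = r n * real n powr (1 - \<alpha> * p / 2))"
proof -
  let ?q = "(1 - \<alpha>) * p / 2"
  let ?S = "\<lambda>n. \<Sum>k = 1..n. unit_increment_variance \<alpha> k powr (p / 2)"
  let ?l = "hadamard_weight_laplace ((\<alpha> - 1) / 2) 0 / Gamma \<alpha>"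
  let ?A = "gauss_abs_moment p * T powr (p / 2)"
  have l: "?l > 0" using \<alpha> by (intro divide_pos_pos hadamard_weight_laplace_pos Gamma_real_pos) auto
  have A: "?A > 0" using assms nn_integral_gauss_abs_moment(2) by simp
  have q: "?q > 0" using assms by simp
  have "(\<lambda>k. (unit_increment_variance \<alpha> k / real k powr (1 - \<alpha>)) powr (p / 2)) \<longlonglongrightarrow> ?l powr (p / 2)"
    using l by (intro tendsto_powr unit_increment_variance_asymp \<alpha> tendsto_const) auto
  moreover have "(unit_increment_variance \<alpha> k / real k powr (1 - \<alpha>)) powr (p / 2) =
      unit_increment_variance \<alpha> k powr (p / 2) / real k powr ?q" for k
    using unit_increment_variance_pos[OF \<alpha>, of k]
    by (simp add: powr_divide powr_powr)
  ultimately have "(\<lambda>k. unit_increment_variance \<alpha> k powr (p / 2) / real k powr ?q) \<longlonglongrightarrow> ?l powr (p / 2)"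
    by simp
  from sum_asymp_powr[OF q this]
  have S: "(\<lambda>n. ?S n / real n powr (?q + 1)) \<longlonglongrightarrow> ?l powr (p / 2) / (?q + 1)" .
  let ?r = "\<lambda>n. ?A * (?S n / real n powr (?q + 1))"
  have "?r \<longlonglongrightarrow> ?A * (?l powr (p / 2) / (?q + 1))"
    by (intro tendsto_mult tendsto_const S)
  moreover have "?A * (?l powr (p / 2) / (?q + 1)) > 0"
    by (intro mult_pos_pos[OF A] divide_pos_pos powr_gt_zero[THEN iffD2]) (use l q in auto)
  moreover have "gauss_abs_moment p * (T / real n) powr (p / 2) * ?S n =
      ?r n * real n powr (1 - \<alpha> * p / 2)" if "1 \<le> n" for n
  proof -
    have "1 - \<alpha> * p / 2 = ?q + 1 - p / 2" by (simp add: field_simps)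
    then have "real n powr (1 - \<alpha> * p / 2) = real n powr (?q + 1 - p / 2)"
      by (rule arg_cong)
    also have "\<dots> = real n powr (?q + 1) / real n powr (p / 2)"
      by (rule powr_diff)
    finally have "real n powr (1 - \<alpha> * p / 2) = real n powr (?q + 1) / real n powr (p / 2)" .
    moreover have "real n powr (?q + 1) \<noteq> 0" using that by simp
    ultimately show ?thesis using \<open>0 < T\<close> that by (simp add: powr_divide)
  qed
  ultimately show ?thesis by (intro exI[of _ "?A * (?l powr (p / 2) / (?q + 1))"] conjI exI[of _ ?r]) auto
qed

theorem theorem5p2:
  fixes M :: "'a measure" and B X :: "real \<Rightarrow> 'a \<Rightarrow> real" and \<alpha> T :: real
  assumes "standard_brownian_motion M B"
    and "0 < \<alpha>" and "\<alpha> < 1"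
    and "hadamard_fBm M B \<alpha> X"
    and "0 < T"
  shows "(\<forall>p>0.
            (p = 2 / \<alpha> \<longrightarrow> (\<exists>V. has_p_variation M X p T V \<and> V \<noteq> 0 \<and> V \<noteq> \<infinity>)) \<and>
            (p > 2 / \<alpha> \<longrightarrow> has_p_variation M X p T 0) \<and>
            (p < 2 / \<alpha> \<longrightarrow> has_p_variation M X p T \<infinity>)) \<and>
         has_p_variation M X 2 T \<infinity>"
proof -
  interpret standard_brownian_motion M B by fact
  have main: "(p = 2 / \<alpha> \<longrightarrow> (\<exists>V. has_p_variation M X p T V \<and> V \<noteq> 0 \<and> V \<noteq> \<infinity>)) \<and>
      (p > 2 / \<alpha> \<longrightarrow> has_p_variation M X p T 0) \<and>
      (p < 2 / \<alpha> \<longrightarrow> has_p_variation M X p T \<infinity>)" if "p > 0" for p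
  proof -
    let ?e = "1 - \<alpha> * p / 2"
    obtain L r where L: "L > 0" "r \<longlonglongrightarrow> L"
      and r: "\<And>n. n \<ge> 1 \<Longrightarrow> gauss_abs_moment p * (T / real n) powr (p / 2) *
        (\<Sum>k = 1..n. unit_increment_variance \<alpha> k powr (p / 2)) = r n * real n powr ?e"
      using hadamard_scaled_variation_asymp[OF assms(2,3,5) \<open>p > 0\<close>] by blast
    have var: "has_p_variation M X p T V" if "(\<lambda>n. ennreal (r n * real n powr ?e)) \<longlonglongrightarrow> V" for V
      unfolding has_p_variation_def using that
    proof (rule Lim_transform_eventually)
      show "eventually (\<lambda>n. ennreal (r n * real n powr ?e) = (\<integral>\<^sup>+ \<omega>. ennreal (\<Sum>k = 1..n.
          \<bar>X (T * real k / real n) \<omega> - X (T * (real k - 1) / real n) \<omega>\<bar> powr p) \<partial>M)) sequentially"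
        using hadamard_expected_variation[OF assms(4,2,3,5) \<open>p > 0\<close>] r
        by (intro eventually_sequentiallyI[of 1]) simp
    qed
    have 1: "\<exists>V. has_p_variation M X p T V \<and> V \<noteq> 0 \<and> V \<noteq> \<infinity>" if "p = 2 / \<alpha>"
    proof -
      have "?e = 0" using that assms by simp
      then have "(\<lambda>n. r n * real n powr ?e) \<longlonglongrightarrow> L"
        using L(2) by (intro Lim_transform_eventually[OF L(2)] eventually_sequentiallyI[of 1]) simp
      then have "has_p_variation M X p T (ennreal L)"
        by (intro var tendsto_ennrealI)
      then show ?thesis using L(1) by (intro exI[of _ "ennreal L"]) auto
    qed
    have 2: "has_p_variation M X p T 0" if "p > 2 / \<alpha>"
    proof -
      have "?e < 0" using that assms by (simp add: field_simps)
      then have "(\<lambda>n. real n powr ?e) \<longlonglongrightarrow> 0" by real_asymp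
      from tendsto_mult[OF L(2) this] show ?thesis
        using tendsto_ennrealI by (intro var) fastforce
    qed
    have 3: "has_p_variation M X p T \<infinity>" if "p < 2 / \<alpha>"
    proof -
      have "?e > 0" using that assms by (simp add: field_simps)
      then have "filterlim (\<lambda>n. real n powr ?e) at_top sequentially" by real_asymp
      from filterlim_tendsto_pos_mult_at_top[OF L(2,1) this] show ?thesis
        by (intro var) (simp add: ennreal_tendsto_top_eq_at_top)
    qed
    show ?thesis using 1 2 3 by blast
  qed
  moreover have "(2::real) < 2 / \<alpha>" using assms by (simp add: field_simps)
  ultimately show ?thesis by auto
qed

end
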